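(* Let $T>0$ and let $X=(X_t)_{t\in[0,T]}$ be a zero-mean Gaussian process with $X_0=0$. Assume that there is a constant $C$ such that for all $n$ $$\max_{1\le k\le in-1}\ \sum_{j=1}^{in-1}\big|d^{\widehat X,in}_{j,k}\big|\le C,\qquad i=1,2,$$ and that there are real numbers $\Sigma_{ij}$ with $$n\,\operatorname{cov}\big((in)^{-1}V^{\widehat X}_{in,T},\,(jn)^{-1}V^{\widehat X}_{jn,T}\big)\longrightarrow \Sigma_{ij}\quad (n\to\infty)\qquad\text{for all } i,j\in\{1,2\}.$$ Then, as $n\to\infty$, $$\sqrt n\begin{pmatrix} n^{-1}\big(V^{\widehat X}_{n,T}-\mathbf{E} V^{\widehat X}_{n,T}\big)\\ (2n)^{-1}\big(V^{\widehat X}_{2n,T}-\mathbf{E} V^{\widehat X}_{2n,T}\big)\end{pmatrix}\xrightarrow{\ d\ }\mathcal N(0;\Sigma),\qquad \Sigma=\begin{pmatrix}\Sigma_{11}&\Sigma_{12}\\ \Sigma_{12}&\Sigma_{22}\end{pmatrix},$$ where $\mathcal N(0;\Sigma)$ is a (centered) Gaussian vector with covariance matrix $\Sigma$.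
   Context: For an integer $N\ge 2$ (used with $N=in$, the product of $i\in\{1,2\}$ and $n$) and $1\le k\le N-1$ put $$\Delta^{(2)}_{N,k}X=X_{\frac{k+1}{N}T}-2X_{\frac kN T}+X_{\frac{k-1}{N}T},\qquad \Delta^{(2)}_{N,k}\widehat X=\frac{\Delta^{(2)}_{N,k}X}{\sqrt{\mathbf{E}(\Delta^{(2)}_{N,k}X)^2}},$$ where it is understood that $\mathbf{E}(\Delta^{(2)}_{N,k}X)^2>0$, so that the normalized increments are defined. Further $$V^{\widehat X}_{N,T}=\sum_{k=1}^{N-1}\big(\Delta^{(2)}_{N,k}\widehat X\big)^2,\qquad d^{\widehat X,N}_{j,k}=\mathbf{E}\big[\Delta^{(2)}_{N,j}\widehat X\,\Delta^{(2)}_{N,k}\widehat X\big],\quad 1\le j,k\le N-1.$$ Empty sums and maxima (case $N=1$) are taken to be $0$. *)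

theory Defs
  imports "HOL-Probability.Probability"
begin

text \<open>
  A real Gaussian random variable may be degenerate, i.e. almost surely constant.  This case is
  listed separately because \<^const>\<open>normal_density\<close> is the zero function for
  standard deviation 0.
\<close>

definition gaussian_rv :: "'a measure \<Rightarrow> ('a \<Rightarrow> real) \<Rightarrow> bool" where
  "gaussian_rv M Y \<longleftrightarrow> Y \<in> borel_measurable M \<and>
     ((\<exists>m. AE \<omega> in M. Y \<omega> = m) \<or>
      (\<exists>m s. 0 < s \<and> distributed M lborel Y (normal_density m s)))"

text \<open>
  Joint Gaussianity of the finite-dimensional distributions, in the usual form: every finite
  linear combination of the variables is Gaussian.
\<close>

definition gaussian_process :: "'a measure \<Rightarrow> 't set \<Rightarrow> ('t \<Rightarrow> 'a \<Rightarrow> real) \<Rightarrow> bool" where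
  "gaussian_process M I X \<longleftrightarrow>
     (\<forall>F c. finite F \<longrightarrow> F \<subseteq> I \<longrightarrow> gaussian_rv M (\<lambda>\<omega>. \<Sum>t\<in>F. c t * X t \<omega>))"

definition covariance :: "'a measure \<Rightarrow> ('a \<Rightarrow> real) \<Rightarrow> ('a \<Rightarrow> real) \<Rightarrow> real" where
  "covariance M Y Z =
     (\<integral>\<omega>. (Y \<omega> - (\<integral>\<omega>'. Y \<omega>' \<partial>M)) * (Z \<omega> - (\<integral>\<omega>'. Z \<omega>' \<partial>M)) \<partial>M)"

text \<open>
  \<open>is_multivariate_normal m S \<nu>\<close>: \<open>\<nu>\<close> is the law of a Gaussian vector with mean \<open>m\<close> and
  covariance matrix \<open>S\<close> (which may be singular).
\<close>

definition is_multivariate_normal ::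
    "real ^ 'n \<Rightarrow> real ^ 'n ^ 'n \<Rightarrow> (real ^ 'n) measure \<Rightarrow> bool" where
  "is_multivariate_normal m S \<nu> \<longleftrightarrow>
     prob_space \<nu> \<and> sets \<nu> = sets borel \<and>
     (\<forall>a. gaussian_rv \<nu> (\<lambda>x. a \<bullet> x)) \<and>
     (\<forall>i. (\<integral>x. x $ i \<partial>\<nu>) = m $ i) \<and>
     (\<forall>i j. covariance \<nu> (\<lambda>x. x $ i) (\<lambda>x. x $ j) = S $ i $ j)"

text \<open>The library's \<^const>\<open>weak_conv_m\<close> only covers laws on the real line.\<close>

definition converges_in_distribution ::
    "'a measure \<Rightarrow> (nat \<Rightarrow> 'a \<Rightarrow> 'b::topological_space) \<Rightarrow> 'b measure \<Rightarrow> bool" where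
  "converges_in_distribution M Z \<nu> \<longleftrightarrow>
     (\<forall>n. Z n \<in> borel_measurable M) \<and>
     (\<forall>f :: 'b \<Rightarrow> real. continuous_on UNIV f \<longrightarrow> bounded (range f) \<longrightarrow>
        (\<lambda>n. \<integral>x. f x \<partial>(distr M borel (Z n))) \<longlonglongrightarrow> (\<integral>x. f x \<partial>\<nu>))"

definition second_diff :: "(real \<Rightarrow> 'a \<Rightarrow> real) \<Rightarrow> real \<Rightarrow> nat \<Rightarrow> nat \<Rightarrow> 'a \<Rightarrow> real" where
  "second_diff X T N k \<omega> =
     X ((real k + 1) / real N * T) \<omega> - 2 * X (real k / real N * T) \<omega>
       + X ((real k - 1) / real N * T) \<omega>"

definition normalized_second_diff ::
    "'a measure \<Rightarrow> (real \<Rightarrow> 'a \<Rightarrow> real) \<Rightarrow> real \<Rightarrow> nat \<Rightarrow> nat \<Rightarrow> 'a \<Rightarrow> real" where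
  "normalized_second_diff M X T N k \<omega> =
     second_diff X T N k \<omega> / sqrt (\<integral>\<omega>'. (second_diff X T N k \<omega>')\<^sup>2 \<partial>M)"

definition quadratic_variation ::
    "'a measure \<Rightarrow> (real \<Rightarrow> 'a \<Rightarrow> real) \<Rightarrow> real \<Rightarrow> nat \<Rightarrow> 'a \<Rightarrow> real" where
  "quadratic_variation M X T N \<omega> = (\<Sum>k=1..N-1. (normalized_second_diff M X T N k \<omega>)\<^sup>2)"

definition diff_corr ::
    "'a measure \<Rightarrow> (real \<Rightarrow> 'a \<Rightarrow> real) \<Rightarrow> real \<Rightarrow> nat \<Rightarrow> nat \<Rightarrow> nat \<Rightarrow> real" where
  "diff_corr M X T N j k =
     (\<integral>\<omega>. normalized_second_diff M X T N j \<omega> * normalized_second_diff M X T N k \<omega> \<partial>M)"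

text \<open>The maximum over the empty index range (\<open>N \<le> 1\<close>) is 0 by convention.\<close>

definition max_corr_sum :: "'a measure \<Rightarrow> (real \<Rightarrow> 'a \<Rightarrow> real) \<Rightarrow> real \<Rightarrow> nat \<Rightarrow> real" where
  "max_corr_sum M X T N =
     (if 2 \<le> N then Max ((\<lambda>k. \<Sum>j=1..N-1. \<bar>diff_corr M X T N j k\<bar>) ` {1..N-1}) else 0)"

end

theory Submission
  imports Defs "HOL-Real_Asymp.Real_Asymp"
begin

text \<open>
  Fix reals \<open>a\<close>, \<open>b\<close> and collect the normalized second differences of the levels \<open>n\<close> and \<open>2n\<close>
  into one vector \<open>Y\<close> of jointly Gaussian standard variables.  The combination of the two
  fluctuations with coefficients \<open>a\<close>, \<open>b\<close> is \<open>Q = \<Sum>l. w l * ((Y l)\<^sup>2 - 1)\<close> with weights of order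
  \<open>1 / sqrt n\<close>, and its variance converges by hypothesis.  So the point is that \<open>Q\<close> is
  asymptotically Gaussian, and this follows from two facts: the weights are uniformly small, and
  the correlation matrix \<open>R\<close> of \<open>Y\<close> is bounded as an operator.
  
  Let \<open>\<phi> t = E exp (i t Q)\<close>.  Gaussian integration by parts
  (\<open>gaussian_integration_by_parts\<close>) expresses \<open>E (Y j * Y k * exp (i t Q))\<close> as
  \<open>R j k * \<phi> t + 2 i t (\<Sum>p. w p * R j p * E (Y k * Y p * exp (i t Q)))\<close>.  Using this twice in
  \<open>\<phi>' t = i (\<Sum>k. w k * (E ((Y k)\<^sup>2 * exp (i t Q)) - \<phi> t))\<close> gives \<open>\<phi>' t = - t * Var Q * \<phi> t + \<epsilon> t\<close>, where
  \<open>\<epsilon> t\<close> is \<open>- 4 i t\<^sup>2\<close> times the expectation of \<open>exp (i t Q)\<close> times the quadratic form of \<open>W R W R W\<close>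
  at \<open>Y\<close>, with \<open>W\<close> the diagonal matrix of the weights.  For \<open>0 \<le> t \<le> 1\<close> the error is at most
  \<open>4 * (number of components) * (max weight)^3 * (norm of R)\<^sup>2\<close>, which is of order \<open>1 / sqrt n\<close>, and
  solving the differential equation yields \<open>\<phi> 1 = exp (- Var Q / 2) + O(1 / sqrt n)\<close>
  (\<open>characteristic_function_quadratic_form\<close>).
  
  The row sum hypothesis concerns the correlations within one level.  Row sums bound the operator
  norm of each diagonal block of \<open>R\<close>, and since \<open>R\<close> is positive semidefinite, twice that bound
  holds for the full matrix, which includes the correlations between the levels
  (\<open>quadratic_form_two_blocks\<close>).
  
  The probabilistic input is that the linear combinations of finitely many random variables
  determine their joint law (\<open>joint_law_unique\<close>): it makes a component of a Gaussian vector
  independent of the residuals of the regression on it, and integration by parts becomes the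
  one-dimensional one.  Finally, convergence of characteristic functions together with bounded
  second moments implies convergence in distribution
  (\<open>levy_continuity_bounded_second_moment\<close>), the limit being the bivariate normal law of
  \<open>bivariate_normal_exists\<close>.
\<close>

section \<open>Centered Gaussian variables\<close>

lemma std_normal_scaled:
  assumes "0 < s"
  shows "distr std_normal_distribution borel (\<lambda>x. s * x) = density lborel (normal_density 0 s)"
proof -
  interpret N: prob_space std_normal_distribution
    by (rule prob_space_normal_density) auto
  have "distributed std_normal_distribution lborel (\<lambda>x. x) (normal_density 0 1)"
    by (auto simp: distributed_def distr_id2)
  from N.normal_density_affine[OF this, of s 0] assms
  have "distributed std_normal_distribution lborel (\<lambda>x. s * x) (normal_density 0 s)"
    by simp
  then have "distr std_normal_distribution lborel (\<lambda>x. s * x) = density lborel (normal_density 0 s)"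
    by (simp add: distributed_def)
  moreover have "distr std_normal_distribution lborel (\<lambda>x. s * x) = distr std_normal_distribution borel (\<lambda>x. s * x)"
    by (rule distr_cong) auto
  ultimately show ?thesis by simp
qed

text \<open>
  Writing the law as that of a multiple of a standard normal variable covers constant variables
  as well, the factor then being 0, so moments and characteristic functions follow uniformly.
\<close>

lemma centered_gaussian_law:
  assumes "prob_space M" "gaussian_rv M Z" "(\<integral>\<omega>. Z \<omega> \<partial>M) = 0"
  shows "distr M borel Z =
    distr std_normal_distribution borel (\<lambda>x. sqrt (\<integral>\<omega>. (Z \<omega>)\<^sup>2 \<partial>M) * x)"
proof -
  interpret prob_space M by fact
  have Z[measurable]: "Z \<in> borel_measurable M"
    using assms(2) by (simp add: gaussian_rv_def)
  consider (c) m where "AE \<omega> in M. Z \<omega> = m"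
    | (n) m s where "0 < s" "distributed M lborel Z (normal_density m s)"
    using assms(2) unfolding gaussian_rv_def by auto
  then show ?thesis
  proof cases
    case c
    have "(\<integral>\<omega>. Z \<omega> \<partial>M) = (\<integral>\<omega>. m \<partial>M)"
      by (rule integral_cong_AE) (use c in auto)
    then have "m = 0" using assms(3) by (simp add: prob_space)
    with c have Z0: "AE \<omega> in M. Z \<omega> = 0" by simp
    have "(\<integral>\<omega>. (Z \<omega>)\<^sup>2 \<partial>M) = (\<integral>\<omega>. 0 \<partial>M)"
      by (rule integral_cong_AE) (use Z0 in auto)
    moreover have "distr M borel Z = distr M borel (\<lambda>_. 0)"
      by (rule distr_cong_AE) (use Z0 in auto)
    moreover have "distr M borel (\<lambda>_. 0) = return borel (0::real)"
      by (subst distr_const) auto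
    moreover have "distr std_normal_distribution borel (\<lambda>_. 0) = return borel (0::real)"
      by (rule prob_space.distr_const[OF prob_space_normal_density]) auto
    ultimately show ?thesis by simp
  next
    case n
    have "m = 0" using normal_distributed_expectation[OF n(1,2)] assms(3) by simp
    have var: "(\<integral>\<omega>. (Z \<omega>)\<^sup>2 \<partial>M) = s\<^sup>2"
      using normal_distributed_variance[OF n(1,2)] assms(3) by simp
    have "distr M borel Z = distr M lborel Z"
      by (rule distr_cong) auto
    also have "\<dots> = density lborel (normal_density 0 s)"
      using n(2) \<open>m = 0\<close> by (simp add: distributed_def)
    finally have 1: "distr M borel Z = density lborel (normal_density 0 s)" .
    show ?thesis using 1 var n(1) std_normal_scaled[OF n(1)] by simp
  qed
qed

lemma centered_gaussian_integral:
  fixes f :: "real \<Rightarrow> 'b::{banach, second_countable_topology}"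
  assumes "prob_space M" "gaussian_rv M Z" "(\<integral>\<omega>. Z \<omega> \<partial>M) = 0"
    and [measurable]: "f \<in> borel_measurable borel"
  shows "(\<integral>\<omega>. f (Z \<omega>) \<partial>M) = (\<integral>x. f (sqrt (\<integral>\<omega>. (Z \<omega>)\<^sup>2 \<partial>M) * x) \<partial>std_normal_distribution)"
    and "integrable M (\<lambda>\<omega>. f (Z \<omega>)) \<longleftrightarrow>
      integrable std_normal_distribution (\<lambda>x. f (sqrt (\<integral>\<omega>. (Z \<omega>)\<^sup>2 \<partial>M) * x))"
proof -
  have Z[measurable]: "Z \<in> borel_measurable M"
    using assms(2) by (simp add: gaussian_rv_def)
  let ?s = "sqrt (\<integral>\<omega>. (Z \<omega>)\<^sup>2 \<partial>M)"
  have "(\<integral>\<omega>. f (Z \<omega>) \<partial>M) = (\<integral>x. f x \<partial>distr M borel Z)"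
    by (subst integral_distr) auto
  also have "\<dots> = (\<integral>x. f (?s * x) \<partial>std_normal_distribution)"
    unfolding centered_gaussian_law[OF assms(1-3)] by (subst integral_distr) auto
  finally show "(\<integral>\<omega>. f (Z \<omega>) \<partial>M) = (\<integral>x. f (?s * x) \<partial>std_normal_distribution)" .
  have "integrable M (\<lambda>\<omega>. f (Z \<omega>)) \<longleftrightarrow> integrable (distr M borel Z) f"
    by (subst integrable_distr_eq) auto
  also have "\<dots> \<longleftrightarrow> integrable std_normal_distribution (\<lambda>x. f (?s * x))"
    unfolding centered_gaussian_law[OF assms(1-3)] by (subst integrable_distr_eq) auto
  finally show "integrable M (\<lambda>\<omega>. f (Z \<omega>)) \<longleftrightarrow> integrable std_normal_distribution (\<lambda>x. f (?s * x))" .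
qed

lemma centered_gaussian_power_integrable:
  assumes "prob_space M" "gaussian_rv M Z" "(\<integral>\<omega>. Z \<omega> \<partial>M) = 0"
  shows "integrable M (\<lambda>\<omega>. Z \<omega> ^ k)"
  using centered_gaussian_integral(2)[OF assms, of "\<lambda>x. x ^ k"]
  by (simp add: power_mult_distrib integrable_std_normal_distribution_moment)

lemma centered_gaussian_fourth_moment:
  assumes "prob_space M" "gaussian_rv M Z" "(\<integral>\<omega>. Z \<omega> \<partial>M) = 0"
  shows "(\<integral>\<omega>. Z \<omega> ^ 4 \<partial>M) = 3 * (\<integral>\<omega>. (Z \<omega>)\<^sup>2 \<partial>M)\<^sup>2"
proof -
  let ?v = "\<integral>\<omega>. (Z \<omega>)\<^sup>2 \<partial>M"
  have v: "0 \<le> ?v" by simp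
  have s: "sqrt ?v ^ 4 = ?v\<^sup>2"
    using power_mult[of "sqrt ?v" 2 2] v by simp
  have "(\<integral>x. x ^ 4 \<partial>std_normal_distribution) = 3"
    using std_normal_distribution_even_moments[of 2]
    by (simp add: fact_numeral has_bochner_integral_iff)
  then show ?thesis
    using centered_gaussian_integral(1)[OF assms, of "\<lambda>x. x ^ 4"] s
    by (simp add: power_mult_distrib)
qed

lemma centered_gaussian_char:
  assumes "prob_space M" "gaussian_rv M Z" "(\<integral>\<omega>. Z \<omega> \<partial>M) = 0"
  shows "(\<integral>\<omega>. iexp (Z \<omega>) \<partial>M) = of_real (exp (- (\<integral>\<omega>. (Z \<omega>)\<^sup>2 \<partial>M) / 2))"
proof -
  have "(\<integral>\<omega>. iexp (Z \<omega>) \<partial>M) = char std_normal_distribution (sqrt (\<integral>\<omega>. (Z \<omega>)\<^sup>2 \<partial>M))"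
    unfolding char_def by (rule centered_gaussian_integral(1)[OF assms]) auto
  then show ?thesis by (simp add: char_std_normal_distribution)
qed

section \<open>Linear combinations determine the joint law\<close>

text \<open>
  Dividing by the common total mass turns both weights into probability densities, to which the
  uniqueness theorem for characteristic functions on the line applies.
\<close>

lemma weighted_law_unique:
  fixes V :: "'a \<Rightarrow> real" and V' :: "'b \<Rightarrow> real"
  assumes int: "integrable M V" "integrable M' V'"
    and pos: "\<And>\<omega>. 0 \<le> V \<omega>" "\<And>\<omega>. 0 \<le> V' \<omega>"
    and [measurable]: "Y \<in> borel_measurable M" "Y' \<in> borel_measurable M'"
    and eq: "\<And>s. (\<integral>\<omega>. V \<omega> *\<^sub>R iexp (s * Y \<omega>) \<partial>M) = (\<integral>\<omega>. V' \<omega> *\<^sub>R iexp (s * Y' \<omega>) \<partial>M')"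
    and [measurable]: "B \<in> sets borel"
  shows "(\<integral>\<omega>. V \<omega> * indicator B (Y \<omega>) \<partial>M) = (\<integral>\<omega>. V' \<omega> * indicator B (Y' \<omega>) \<partial>M')"
proof -
  have [measurable]: "V \<in> borel_measurable M" "V' \<in> borel_measurable M'"
    using int by auto
  define c where "c = (\<integral>\<omega>. V \<omega> \<partial>M)"
  have c': "c = (\<integral>\<omega>. V' \<omega> \<partial>M')"
    using eq[of 0] int unfolding c_def by (simp add: integral_of_real scaleR_conv_of_real)
  have c0: "0 \<le> c" unfolding c_def using pos by simp
  show ?thesis
  proof (cases "c = 0")
    case True
    have "AE \<omega> in M. V \<omega> = 0"
      using True pos int unfolding c_def by (subst (asm) integral_nonneg_eq_0_iff_AE) auto
    then have "(\<integral>\<omega>. V \<omega> * indicator B (Y \<omega>) \<partial>M) = (\<integral>\<omega>. 0 \<partial>M)"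
      by (intro integral_cong_AE) auto
    moreover have "AE \<omega> in M'. V' \<omega> = 0"
      using True pos int unfolding c' by (subst (asm) integral_nonneg_eq_0_iff_AE) auto
    then have "(\<integral>\<omega>. V' \<omega> * indicator B (Y' \<omega>) \<partial>M') = (\<integral>\<omega>. 0 \<partial>M')"
      by (intro integral_cong_AE) auto
    ultimately show ?thesis by simp
  next
    case False
    with c0 have cp: "0 < c" by simp
    have *: "prob_space (density N (\<lambda>\<omega>. ennreal (W \<omega> / c)))"
      if "integrable N W" "\<And>\<omega>. 0 \<le> W \<omega>" "(\<integral>\<omega>. W \<omega> \<partial>N) = c" for N :: "'x measure" and W
    proof (rule prob_spaceI)
      have [measurable]: "W \<in> borel_measurable N" using that by auto
      have "emeasure (density N (\<lambda>\<omega>. ennreal (W \<omega> / c))) (space N) = (\<integral>\<^sup>+\<omega>. ennreal (W \<omega> / c) \<partial>N)"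
        by (subst emeasure_density) (auto intro!: nn_integral_cong)
      also have "\<dots> = ennreal (\<integral>\<omega>. W \<omega> / c \<partial>N)"
        using that cp by (intro nn_integral_eq_integral) auto
      also have "\<dots> = 1" using that cp by simp
      finally show "emeasure (density N (\<lambda>\<omega>. ennreal (W \<omega> / c))) (space (density N (\<lambda>\<omega>. ennreal (W \<omega> / c)))) = 1"
        by simp
    qed
    let ?P = "density M (\<lambda>\<omega>. ennreal (V \<omega> / c))" and ?P' = "density M' (\<lambda>\<omega>. ennreal (V' \<omega> / c))"
    interpret P: prob_space ?P by (rule *) (use int pos c_def in auto)
    interpret P': prob_space ?P' by (rule *) (use int pos c' in auto)
    have D: "real_distribution (distr ?P borel Y)" "real_distribution (distr ?P' borel Y')"
      by (auto intro!: P.real_distribution_distr P'.real_distribution_distr)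
    have ch: "char (distr ?P borel Y) s = (\<integral>\<omega>. V \<omega> *\<^sub>R iexp (s * Y \<omega>) \<partial>M) / c" for s
      unfolding char_def using cp pos
      by (subst integral_distr; (subst integral_density)?) (auto simp flip: integral_divide_zero simp: scaleR_conv_of_real field_simps)
    have ch': "char (distr ?P' borel Y') s = (\<integral>\<omega>. V' \<omega> *\<^sub>R iexp (s * Y' \<omega>) \<partial>M') / c" for s
      unfolding char_def using cp pos
      by (subst integral_distr; (subst integral_density)?) (auto simp flip: integral_divide_zero simp: scaleR_conv_of_real field_simps)
    have "distr ?P borel Y = distr ?P' borel Y'"
      by (rule Levy_uniqueness[OF D]) (rule ext, simp only: ch ch' eq)
    moreover have "(\<integral>x. indicator B x \<partial>distr ?P borel Y) = (\<integral>\<omega>. V \<omega> / c * indicator B (Y \<omega>) \<partial>M)"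
      using cp pos by (subst integral_distr; (subst integral_real_density)?) auto
    moreover have "(\<integral>x. indicator B x \<partial>distr ?P' borel Y') = (\<integral>\<omega>. V' \<omega> / c * indicator B (Y' \<omega>) \<partial>M')"
      using cp pos by (subst integral_distr; (subst integral_real_density)?) auto
    ultimately have "(\<integral>\<omega>. V \<omega> / c * indicator B (Y \<omega>) \<partial>M) = (\<integral>\<omega>. V' \<omega> / c * indicator B (Y' \<omega>) \<partial>M')"
      by metis
    then show ?thesis using cp by simp
  qed
qed

text \<open>
  A complex weight \<open>V\<close> with \<open>\<bar>V\<bar> \<le> 1\<close> is recovered from the nonnegative weights \<open>1\<close>, \<open>1 + Re V\<close> and
  \<open>1 + Im V\<close>.  Their transforms are combinations of those of \<open>1\<close>, \<open>V\<close> and the conjugate of \<open>V\<close>,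
  and the transform of the conjugate is obtained from that of \<open>V\<close> by conjugation and reflection.
\<close>

lemma complex_weighted_law_unique:
  fixes V :: "'a \<Rightarrow> complex" and V' :: "'b \<Rightarrow> complex"
  assumes P: "prob_space M" "prob_space M'"
    and [measurable]: "V \<in> borel_measurable M" "V' \<in> borel_measurable M'"
    and bnd: "\<And>\<omega>. norm (V \<omega>) \<le> 1" "\<And>\<omega>. norm (V' \<omega>) \<le> 1"
    and [measurable]: "Y \<in> borel_measurable M" "Y' \<in> borel_measurable M'"
    and eq: "\<And>s. (\<integral>\<omega>. V \<omega> * iexp (s * Y \<omega>) \<partial>M) = (\<integral>\<omega>. V' \<omega> * iexp (s * Y' \<omega>) \<partial>M')"
    and eq1: "\<And>s. (\<integral>\<omega>. iexp (s * Y \<omega>) \<partial>M) = (\<integral>\<omega>. iexp (s * Y' \<omega>) \<partial>M')"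
    and [measurable]: "B \<in> sets borel"
  shows "(\<integral>\<omega>. V \<omega> * of_real (indicator B (Y \<omega>)) \<partial>M) = (\<integral>\<omega>. V' \<omega> * of_real (indicator B (Y' \<omega>)) \<partial>M')"
proof -
  interpret M: prob_space M by fact
  interpret M': prob_space M' by fact
  have "cnj \<in> borel_measurable borel"
    by (intro borel_measurable_continuous_onI continuous_intros)
  from this[measurable] have [measurable]: "(\<lambda>\<omega>. cnj (V \<omega>)) \<in> borel_measurable M"
    "(\<lambda>\<omega>. cnj (V' \<omega>)) \<in> borel_measurable M'"
    by measurable
  have int: "integrable M (\<lambda>\<omega>. V \<omega> * iexp (s * Y \<omega>))" "integrable M (\<lambda>\<omega>. iexp (s * Y \<omega>))"
    "integrable M (\<lambda>\<omega>. cnj (V \<omega>) * iexp (s * Y \<omega>))" for s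
    by (auto intro!: M.integrable_const_bound[of _ 1] simp: norm_mult bnd)
  have int': "integrable M' (\<lambda>\<omega>. V' \<omega> * iexp (s * Y' \<omega>))" "integrable M' (\<lambda>\<omega>. iexp (s * Y' \<omega>))"
    "integrable M' (\<lambda>\<omega>. cnj (V' \<omega>) * iexp (s * Y' \<omega>))" for s
    by (auto intro!: M'.integrable_const_bound[of _ 1] simp: norm_mult bnd)
  have eqc: "(\<integral>\<omega>. cnj (V \<omega>) * iexp (s * Y \<omega>) \<partial>M) = (\<integral>\<omega>. cnj (V' \<omega>) * iexp (s * Y' \<omega>) \<partial>M')" for s
  proof -
    have "(\<integral>\<omega>. cnj (V \<omega>) * iexp (s * Y \<omega>) \<partial>M) = cnj (\<integral>\<omega>. V \<omega> * iexp (- s * Y \<omega>) \<partial>M)"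
      by (subst Bochner_Integration.integral_cnj[symmetric]) (auto intro!: Bochner_Integration.integral_cong simp: exp_cnj)
    also have "\<dots> = cnj (\<integral>\<omega>. V' \<omega> * iexp (- s * Y' \<omega>) \<partial>M')" by (simp only: eq)
    also have "\<dots> = (\<integral>\<omega>. cnj (V' \<omega>) * iexp (s * Y' \<omega>) \<partial>M')"
      by (subst Bochner_Integration.integral_cnj[symmetric]) (auto intro!: Bochner_Integration.integral_cong simp: exp_cnj)
    finally show ?thesis .
  qed
  have main: "(\<integral>\<omega>. Re (u * V \<omega>) * indicator B (Y \<omega>) \<partial>M) = (\<integral>\<omega>. Re (u * V' \<omega>) * indicator B (Y' \<omega>) \<partial>M')"
    if u: "norm u = 1" for u
  proof -
    have le: "\<bar>Re (u * V \<omega>)\<bar> \<le> 1" "\<bar>Re (u * V' \<omega>')\<bar> \<le> 1" for \<omega> \<omega>'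
      using abs_Re_le_cmod[of "u * V \<omega>"] abs_Re_le_cmod[of "u * V' \<omega>'"] bnd(1)[of \<omega>] bnd(2)[of \<omega>'] u
      by (auto simp: norm_mult simp del: complex_Re_le_cmod)
    have i: "integrable M (\<lambda>\<omega>. 1 + Re (u * V \<omega>))" "integrable M' (\<lambda>\<omega>. 1 + Re (u * V' \<omega>))"
      by (intro Bochner_Integration.integrable_add M.integrable_const M'.integrable_const
            M.integrable_const_bound[of _ 1] M'.integrable_const_bound[of _ 1] AE_I2; simp add: le del: times_complex.sel)+
    have ib: "integrable M (\<lambda>\<omega>. Re (u * V \<omega>) * indicator B (Y \<omega>))" "integrable M' (\<lambda>\<omega>. Re (u * V' \<omega>) * indicator B (Y' \<omega>))"
       "integrable M (\<lambda>\<omega>. indicator B (Y \<omega>) :: real)" "integrable M' (\<lambda>\<omega>. indicator B (Y' \<omega>) :: real)"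
      by (auto intro!: M.integrable_const_bound[of _ 1] M'.integrable_const_bound[of _ 1] le mult_le_one simp: abs_mult indicator_def simp del: times_complex.sel)
    \<comment> \<open>Used with \<open>z = u * V \<omega>\<close>, where \<open>u = 1\<close> gives the real and \<open>u = -\<i>\<close> the imaginary part of \<open>V\<close>.\<close>
    have half: "(1 + Re z) *\<^sub>R w = w + (1/2) * (z * w) + (1/2) * (cnj z * w)" for z w
      by (simp add: complex_eq_iff field_simps)
    have ex: "(\<integral>\<omega>. (1 + Re (u * V \<omega>)) *\<^sub>R iexp (s * Y \<omega>) \<partial>M)
       = (\<integral>\<omega>. iexp (s * Y \<omega>) \<partial>M) + (u/2) * (\<integral>\<omega>. V \<omega> * iexp (s * Y \<omega>) \<partial>M) + (cnj u/2) * (\<integral>\<omega>. cnj (V \<omega>) * iexp (s * Y \<omega>) \<partial>M)" for s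
    proof -
      have "(\<integral>\<omega>. (1 + Re (u * V \<omega>)) *\<^sub>R iexp (s * Y \<omega>) \<partial>M) =
        (\<integral>\<omega>. iexp (s * Y \<omega>) + (u/2) * (V \<omega> * iexp (s * Y \<omega>)) + (cnj u/2) * (cnj (V \<omega>) * iexp (s * Y \<omega>)) \<partial>M)"
        by (rule Bochner_Integration.integral_cong[OF refl], subst half) (simp add: mult_ac)
      then show ?thesis using int[of s] by simp
    qed
    have ex': "(\<integral>\<omega>. (1 + Re (u * V' \<omega>)) *\<^sub>R iexp (s * Y' \<omega>) \<partial>M')
       = (\<integral>\<omega>. iexp (s * Y' \<omega>) \<partial>M') + (u/2) * (\<integral>\<omega>. V' \<omega> * iexp (s * Y' \<omega>) \<partial>M') + (cnj u/2) * (\<integral>\<omega>. cnj (V' \<omega>) * iexp (s * Y' \<omega>) \<partial>M')" for s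
    proof -
      have "(\<integral>\<omega>. (1 + Re (u * V' \<omega>)) *\<^sub>R iexp (s * Y' \<omega>) \<partial>M') =
        (\<integral>\<omega>. iexp (s * Y' \<omega>) + (u/2) * (V' \<omega> * iexp (s * Y' \<omega>)) + (cnj u/2) * (cnj (V' \<omega>) * iexp (s * Y' \<omega>)) \<partial>M')"
        by (rule Bochner_Integration.integral_cong[OF refl], subst half) (simp add: mult_ac)
      then show ?thesis using int'[of s] by simp
    qed
    have 1: "(\<integral>\<omega>. (1 + Re (u * V \<omega>)) * indicator B (Y \<omega>) \<partial>M) = (\<integral>\<omega>. (1 + Re (u * V' \<omega>)) * indicator B (Y' \<omega>) \<partial>M')"
    proof (rule weighted_law_unique[OF i])
      show "0 \<le> 1 + Re (u * V \<omega>)" "0 \<le> 1 + Re (u * V' \<omega>')" for \<omega> \<omega>'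
        using le(1)[of \<omega>] le(2)[of \<omega>'] by (simp_all add: abs_le_iff del: times_complex.sel)
    qed (simp_all only: ex ex' eq eq1 eqc, measurable)
    have 2: "(\<integral>\<omega>. indicator B (Y \<omega>) \<partial>M) = (\<integral>\<omega>. indicator B (Y' \<omega>) \<partial>M' :: real)"
      using weighted_law_unique[of M "\<lambda>_. 1" M' "\<lambda>_. 1" Y Y' B] eq1 by simp
    from 1 2 ib show ?thesis by (simp add: distrib_right del: times_complex.sel)
  qed
  have ind: "of_real (indicator B x) = (indicator B x :: complex)" for x :: real
    by (auto simp: indicator_def)
  have i: "integrable M (\<lambda>\<omega>. V \<omega> * of_real (indicator B (Y \<omega>)))" "integrable M' (\<lambda>\<omega>. V' \<omega> * of_real (indicator B (Y' \<omega>)))"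
    by (auto intro!: M.integrable_const_bound[of _ 1] M'.integrable_const_bound[of _ 1] simp: norm_mult indicator_def bnd)
  show ?thesis
    using main[of 1] main[of "-\<i>"] i
    by (simp add: complex_eq_iff integral_Re[symmetric] integral_Im[symmetric] del: integral_Re integral_Im)
qed

text \<open>
  The coordinates are treated one at a time.  Suppose that the expectations of
  \<open>exp (i (\<Sum>l. c l * Y l))\<close> times indicators of events of the coordinates in \<open>J\<close> agree for all \<open>c\<close>.
  Under this product, taken as a complex weight, the transform of a further coordinate \<open>Y m\<close>
  amounts to a change of \<open>c m\<close>, so the one-dimensional uniqueness adds an indicator for \<open>Y m\<close>.
\<close>

lemma joint_law_unique:
  fixes Y :: "'i \<Rightarrow> 'a \<Rightarrow> real" and Y' :: "'i \<Rightarrow> 'b \<Rightarrow> real"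
  assumes P: "prob_space M" "prob_space M'" and I: "finite I"
    and Y: "\<And>l. l \<in> I \<Longrightarrow> Y l \<in> borel_measurable M"
    and Y': "\<And>l. l \<in> I \<Longrightarrow> Y' l \<in> borel_measurable M'"
    and eq: "\<And>c. (\<integral>\<omega>. iexp (\<Sum>l\<in>I. c l * Y l \<omega>) \<partial>M) = (\<integral>\<omega>. iexp (\<Sum>l\<in>I. c l * Y' l \<omega>) \<partial>M')"
  shows "distr M (PiM I (\<lambda>_. borel)) (\<lambda>\<omega>. \<lambda>l\<in>I. Y l \<omega>) = distr M' (PiM I (\<lambda>_. borel)) (\<lambda>\<omega>. \<lambda>l\<in>I. Y' l \<omega>)"
proof -
  interpret M: prob_space M by fact
  interpret M': prob_space M' by fact
  note [measurable] = Y Y'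
  have cyl: "(\<integral>\<omega>. of_real (\<Prod>l\<in>J. indicator (A l) (Y l \<omega>)) * iexp (\<Sum>l\<in>I. c l * Y l \<omega>) \<partial>M) =
      (\<integral>\<omega>. of_real (\<Prod>l\<in>J. indicator (A l) (Y' l \<omega>)) * iexp (\<Sum>l\<in>I. c l * Y' l \<omega>) \<partial>M')"
    if "J \<subseteq> I" "\<And>l. l \<in> I \<Longrightarrow> A l \<in> sets borel" for J A c
    using finite_subset[OF that(1) I] that(1)
  proof (induction J arbitrary: c rule: finite_induct)
    case empty
    then show ?case using eq[of c] by simp
  next
    case (insert m J)
    then have mI: "m \<in> I" and JI: "J \<subseteq> I" by auto
    have [measurable]: "A m \<in> sets borel" using that mI by auto
    have upd: "c' m * z + (\<Sum>l\<in>I. c l * y l) = (\<Sum>l\<in>I. (c(m := c m + c' m)) l * y l)"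
      if "y m = z" for c c' :: "'i \<Rightarrow> real" and y :: "'i \<Rightarrow> real" and z
      using that I mI by (simp add: sum.remove distrib_right)
    have 1: "(\<integral>\<omega>. (of_real (\<Prod>l\<in>J. indicator (A l) (Y l \<omega>)) * iexp (\<Sum>l\<in>I. c l * Y l \<omega>)) * of_real (indicator (A m) (Y m \<omega>)) \<partial>M) =
      (\<integral>\<omega>. (of_real (\<Prod>l\<in>J. indicator (A l) (Y' l \<omega>)) * iexp (\<Sum>l\<in>I. c l * Y' l \<omega>)) * of_real (indicator (A m) (Y' m \<omega>)) \<partial>M')"
    proof (rule complex_weighted_law_unique[OF P])
      have [measurable]: "(\<lambda>\<omega>. \<Prod>l\<in>J. indicator (A l) (Y l \<omega>) :: real) \<in> borel_measurable M"
        "(\<lambda>\<omega>. \<Prod>l\<in>J. indicator (A l) (Y' l \<omega>) :: real) \<in> borel_measurable M'"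
        using JI that by (auto intro!: borel_measurable_prod measurable_compose[OF _ borel_measurable_indicator] Y Y')
      have [measurable]: "(\<lambda>\<omega>. \<Sum>l\<in>I. c l * Y l \<omega>) \<in> borel_measurable M"
        "(\<lambda>\<omega>. \<Sum>l\<in>I. c l * Y' l \<omega>) \<in> borel_measurable M'"
        by (auto intro!: borel_measurable_sum borel_measurable_times Y Y')
      show "(\<lambda>\<omega>. of_real (\<Prod>l\<in>J. indicator (A l) (Y l \<omega>)) * iexp (\<Sum>l\<in>I. c l * Y l \<omega>)) \<in> borel_measurable M"
        "(\<lambda>\<omega>. of_real (\<Prod>l\<in>J. indicator (A l) (Y' l \<omega>)) * iexp (\<Sum>l\<in>I. c l * Y' l \<omega>)) \<in> borel_measurable M'"
        by measurable
      have "\<bar>\<Prod>l\<in>J. indicator (A l) (x l)\<bar> \<le> (1::real)" for x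
        by (auto simp: abs_prod indicator_def intro!: prod_le_1)
      then show "norm (of_real (\<Prod>l\<in>J. indicator (A l) (Y l \<omega>)) * iexp (\<Sum>l\<in>I. c l * Y l \<omega>)) \<le> 1"
        "norm (of_real (\<Prod>l\<in>J. indicator (A l) (Y' l \<omega>')) * iexp (\<Sum>l\<in>I. c l * Y' l \<omega>')) \<le> 1" for \<omega> \<omega>'
        by (simp_all add: norm_mult del: of_real_prod of_real_sum)
      show "Y m \<in> borel_measurable M" "Y' m \<in> borel_measurable M'" using mI by auto
      show "A m \<in> sets borel" by fact
      fix s
      have "(\<integral>\<omega>. of_real (\<Prod>l\<in>J. indicator (A l) (Y l \<omega>)) * iexp (\<Sum>l\<in>I. (c(m := c m + s)) l * Y l \<omega>) \<partial>M) =
         (\<integral>\<omega>. of_real (\<Prod>l\<in>J. indicator (A l) (Y' l \<omega>)) * iexp (\<Sum>l\<in>I. (c(m := c m + s)) l * Y' l \<omega>) \<partial>M')"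
        by (rule insert.IH[OF JI])
      then show "(\<integral>\<omega>. (of_real (\<Prod>l\<in>J. indicator (A l) (Y l \<omega>)) * iexp (\<Sum>l\<in>I. c l * Y l \<omega>)) * iexp (s * Y m \<omega>) \<partial>M) =
         (\<integral>\<omega>. (of_real (\<Prod>l\<in>J. indicator (A l) (Y' l \<omega>)) * iexp (\<Sum>l\<in>I. c l * Y' l \<omega>)) * iexp (s * Y' m \<omega>) \<partial>M')"
        unfolding upd[of "\<lambda>l. Y l _" _ "\<lambda>_. s", OF refl, symmetric] upd[of "\<lambda>l. Y' l _" _ "\<lambda>_. s", OF refl, symmetric]
        by (simp add: distrib_left exp_add mult_ac del: of_real_prod of_real_sum)
      show "(\<integral>\<omega>. iexp (s * Y m \<omega>) \<partial>M) = (\<integral>\<omega>. iexp (s * Y' m \<omega>) \<partial>M')"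
        using eq[of "\<lambda>l. if l = m then s else 0"] I mI
        by (simp add: if_distrib[of "\<lambda>x. x * _"] sum.delta cong: if_cong del: of_real_sum of_real_mult)
    qed
    show ?case
      using 1 insert.hyps by (simp add: mult_ac del: of_real_sum)
  qed
  let ?B = "PiM I (\<lambda>_. borel :: real measure)"
  have m[measurable]: "(\<lambda>\<omega>. \<lambda>l\<in>I. Y l \<omega>) \<in> measurable M ?B" "(\<lambda>\<omega>. \<lambda>l\<in>I. Y' l \<omega>) \<in> measurable M' ?B"
    by (auto intro!: measurable_restrict Y Y')
  show ?thesis
  proof (rule measure_eqI_PiM_finite[OF I])
    fix A assume A: "\<And>l. l \<in> I \<Longrightarrow> A l \<in> sets (borel :: real measure)"
    have S: "Pi\<^sub>E I A \<in> sets ?B" using A I by (intro sets_PiM_I_finite) auto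
    have ind: "indicator (Pi\<^sub>E I A) (\<lambda>l\<in>I. y l) = (\<Prod>l\<in>I. indicator (A l) (y l) :: real)" for y
      using I by (auto simp: indicator_def PiE_iff)
    have re: "(\<integral>\<omega>. (\<Prod>l\<in>I. indicator (A l) (Y l \<omega>)) \<partial>M) = (\<integral>\<omega>. (\<Prod>l\<in>I. indicator (A l) (Y' l \<omega>)) \<partial>M' :: real)"
      using cyl[of I A "\<lambda>_. 0"] A by (simp del: of_real_prod)
    have "measure (distr M ?B (\<lambda>\<omega>. \<lambda>l\<in>I. Y l \<omega>)) (Pi\<^sub>E I A) = (\<integral>x. indicator (Pi\<^sub>E I A) x \<partial>distr M ?B (\<lambda>\<omega>. \<lambda>l\<in>I. Y l \<omega>))"
      using S by simp
    also have "\<dots> = (\<integral>\<omega>. (\<Prod>l\<in>I. indicator (A l) (Y l \<omega>)) \<partial>M)"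
      using S by (subst integral_distr) (auto simp: ind)
    also have "\<dots> = (\<integral>x. indicator (Pi\<^sub>E I A) x \<partial>distr M' ?B (\<lambda>\<omega>. \<lambda>l\<in>I. Y' l \<omega>))"
      unfolding re using S by (subst integral_distr) (auto simp: ind)
    also have "\<dots> = measure (distr M' ?B (\<lambda>\<omega>. \<lambda>l\<in>I. Y' l \<omega>)) (Pi\<^sub>E I A)"
      using S by simp
    finally show "emeasure (distr M ?B (\<lambda>\<omega>. \<lambda>l\<in>I. Y l \<omega>)) (Pi\<^sub>E I A) = emeasure (distr M' ?B (\<lambda>\<omega>. \<lambda>l\<in>I. Y' l \<omega>)) (Pi\<^sub>E I A)"
      by (simp add: finite_measure.emeasure_eq_measure[OF prob_space.finite_measure]
          M.prob_space_distr[OF m(1)] M'.prob_space_distr[OF m(2)])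
  next
    show "range (\<lambda>_::nat. space ?B) \<subseteq> prod_algebra I (\<lambda>_. borel)"
      using I by (auto simp: space_PiM intro!: prod_algebraI_finite)
    show "emeasure (distr M ?B (\<lambda>\<omega>. \<lambda>l\<in>I. Y l \<omega>)) (space ?B) \<noteq> \<infinity>" for i :: nat
      using prob_space.emeasure_space_1[OF M.prob_space_distr[OF m(1)]] by simp
  qed auto
qed

section \<open>Integration by parts for quadratic forms of a Gaussian vector\<close>

text \<open>
  With \<open>n\<close> the normal density, \<open>G' x * n x - x * G x * n x\<close> is the derivative of \<open>G x * n x\<close>, which
  vanishes at both ends of the line because \<open>G\<close> grows at most linearly.
\<close>

lemma std_normal_integration_by_parts:
  fixes G G' :: "real \<Rightarrow> complex"
  assumes deriv: "\<And>x. (G has_vector_derivative G' x) (at x)"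
    and cont: "continuous_on UNIV G'"
    and bound: "\<And>x. norm (G x) \<le> a + b * \<bar>x\<bar>"
    and int: "integrable std_normal_distribution (\<lambda>x. of_real x * G x)"
      "integrable std_normal_distribution G'"
  shows "(\<integral>x. of_real x * G x \<partial>std_normal_distribution) = (\<integral>x. G' x \<partial>std_normal_distribution)"
proof -
  let ?n = std_normal_density
  define F where "F x = ?n x *\<^sub>R G x" for x
  define F' where "F' x = ?n x *\<^sub>R G' x - ?n x *\<^sub>R (of_real x * G x)" for x
  have contG: "continuous_on UNIV G"
    using deriv by (meson continuous_on_eq_continuous_at has_vector_derivative_continuous open_UNIV)
  have [measurable]: "G \<in> borel_measurable borel" "G' \<in> borel_measurable borel"
    using contG cont by (auto intro: borel_measurable_continuous_onI)
  have n': "(?n has_real_derivative - x * ?n x) (at x)" for x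
    unfolding std_normal_density_def by (auto intro!: derivative_eq_intros simp: field_simps)
  have F: "(F has_vector_derivative F' x) (at x)" for x
    unfolding F_def F'_def using n'[of x] deriv[of x]
    by (auto intro!: derivative_eq_intros simp: scaleR_conv_of_real algebra_simps)
  have contn: "continuous_on UNIV ?n"
    by (rule DERIV_continuous_on[OF n'])
  have contF': "continuous_on UNIV F'"
    unfolding F'_def by (intro continuous_intros contn cont contG)
  have i1: "integrable lborel (\<lambda>x. ?n x *\<^sub>R G' x)" "integrable lborel (\<lambda>x. ?n x *\<^sub>R (of_real x * G x))"
    using int by (auto simp: integrable_density)
  have intF': "set_integrable lborel (einterval (-\<infinity>) \<infinity>) F'"
    unfolding set_integrable_def F'_def using i1 by simp
  have lim: "((\<lambda>x. ?n x * (a + b * \<bar>x\<bar>)) \<longlongrightarrow> 0) at_top" "((\<lambda>x. ?n x * (a + b * \<bar>x\<bar>)) \<longlongrightarrow> 0) at_bot"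
    unfolding std_normal_density_def by real_asymp+
  have le: "norm (F x) \<le> ?n x * (a + b * \<bar>x\<bar>)" for x
    unfolding F_def using bound[of x] by (simp add: mult_left_mono)
  have F0: "(F \<longlongrightarrow> 0) at_top" "(F \<longlongrightarrow> 0) at_bot"
    by (rule Lim_null_comparison[OF _ lim(1)] Lim_null_comparison[OF _ lim(2)], simp add: le)+
  have "(LBINT x=-\<infinity>..\<infinity>. F' x) = 0 - 0"
    by (rule interval_integral_FTC_integrable[where F=F])
      (use F contF' intF' F0 in \<open>auto simp: continuous_on_eq_continuous_at ereal_tendsto_simps\<close>)
  then have "(\<integral>x. F' x \<partial>lborel) = 0"
    by (simp add: interval_lebesgue_integral_def set_lebesgue_integral_def)
  then have "(\<integral>x. ?n x *\<^sub>R G' x \<partial>lborel) = (\<integral>x. ?n x *\<^sub>R (of_real x * G x) \<partial>lborel)"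
    unfolding F'_def using i1 by simp
  then show ?thesis by (simp add: integral_density)
qed

lemma norm_integral_le:
  fixes f :: "'a \<Rightarrow> 'b::{banach, second_countable_topology}"
  assumes "integrable M f" "integrable M g" "\<And>x. norm (f x) \<le> g x"
  shows "norm (\<integral>x. f x \<partial>M) \<le> (\<integral>x. g x \<partial>M)"
  using assms by (intro order_trans[OF integral_norm_bound] integral_mono) auto

text \<open>
  The vector may be degenerate and have no density: the second differences at level \<open>n\<close> are linear
  combinations of those at level \<open>2n\<close>.
\<close>

locale standard_gaussian_vector = prob_space M for M :: "'a measure" +
  fixes I :: "'i set" and Y :: "'i \<Rightarrow> 'a \<Rightarrow> real"
  assumes finite_I: "finite I"
    and gaussian: "\<And>c. gaussian_rv M (\<lambda>\<omega>. \<Sum>l\<in>I. c l * Y l \<omega>)"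
    and mean_zero: "\<And>l. l \<in> I \<Longrightarrow> expectation (Y l) = 0"
    and unit_variance: "\<And>l. l \<in> I \<Longrightarrow> expectation (\<lambda>\<omega>. (Y l \<omega>)\<^sup>2) = 1"
begin

definition R :: "'i \<Rightarrow> 'i \<Rightarrow> real" where
  "R k l = expectation (\<lambda>\<omega>. Y k \<omega> * Y l \<omega>)"

lemma sum_single:
  assumes "l \<in> I"
  shows "(\<Sum>i\<in>I. (if i = l then x else 0) * y i) = (x * y l :: real)"
proof -
  have "(\<Sum>i\<in>I. (if i = l then x else 0) * y i) = (\<Sum>i\<in>I. if i = l then x * y i else 0)"
    by (intro sum.cong) auto
  then show ?thesis using assms finite_I by simp
qed

lemma gaussian_component: "l \<in> I \<Longrightarrow> gaussian_rv M (Y l)"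
  using gaussian[of "\<lambda>i. if i = l then 1 else 0"] by (simp add: sum_single)

lemma measurable_Y[measurable]: "l \<in> I \<Longrightarrow> Y l \<in> borel_measurable M"
  using gaussian_component by (simp add: gaussian_rv_def)

lemma integrable_power: "l \<in> I \<Longrightarrow> integrable M (\<lambda>\<omega>. Y l \<omega> ^ k)"
  by (intro centered_gaussian_power_integrable gaussian_component mean_zero prob_space_axioms)

lemma integrable_Y: "l \<in> I \<Longrightarrow> integrable M (Y l)"
  using integrable_power[of l 1] by simp

lemma integrable_mult_Y: "k \<in> I \<Longrightarrow> l \<in> I \<Longrightarrow> integrable M (\<lambda>\<omega>. Y k \<omega> * Y l \<omega>)"
proof -
  assume kl: "k \<in> I" "l \<in> I"
  have "\<bar>x * y\<bar> \<le> x\<^sup>2 + y\<^sup>2" for x y :: real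
    using sum_squares_bound[of "\<bar>x\<bar>" "\<bar>y\<bar>"] mult_nonneg_nonneg[OF abs_ge_zero[of x] abs_ge_zero[of y]]
    unfolding abs_mult power2_abs by linarith
  then show ?thesis
    using kl by (intro Bochner_Integration.integrable_bound[OF Bochner_Integration.integrable_add[OF integrable_power[of k 2] integrable_power[of l 2]]]) auto
qed

lemma R_commute: "R k l = R l k"
  by (simp add: R_def mult.commute)

lemma R_diag: "l \<in> I \<Longrightarrow> R l l = 1"
  using unit_variance[of l] by (simp add: R_def power2_eq_square)

lemma mean_sum: "expectation (\<lambda>\<omega>. \<Sum>l\<in>I. c l * Y l \<omega>) = 0"
  by (subst Bochner_Integration.integral_sum) (auto simp: integrable_Y mean_zero)

lemma expectation_sum_mult_sum:
  "expectation (\<lambda>\<omega>. (\<Sum>k\<in>I. c k * Y k \<omega>) * (\<Sum>l\<in>I. d l * Y l \<omega>)) = (\<Sum>k\<in>I. \<Sum>l\<in>I. c k * d l * R k l)"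
proof -
  have "expectation (\<lambda>\<omega>. (\<Sum>k\<in>I. c k * Y k \<omega>) * (\<Sum>l\<in>I. d l * Y l \<omega>)) =
     expectation (\<lambda>\<omega>. \<Sum>k\<in>I. \<Sum>l\<in>I. c k * d l * (Y k \<omega> * Y l \<omega>))"
    by (simp add: sum_product mult_ac)
  then show ?thesis
    by (simp add: R_def Bochner_Integration.integral_sum integrable_mult_Y Bochner_Integration.integrable_sum)
qed

lemma expectation_sum_sq:
  "expectation (\<lambda>\<omega>. (\<Sum>k\<in>I. c k * Y k \<omega>)\<^sup>2) = (\<Sum>k\<in>I. \<Sum>l\<in>I. c k * c l * R k l)"
  using expectation_sum_mult_sum[of c c] by (simp add: power2_eq_square)

lemma characteristic_function:
  "expectation (\<lambda>\<omega>. iexp (\<Sum>l\<in>I. c l * Y l \<omega>)) = of_real (exp (- (\<Sum>k\<in>I. \<Sum>l\<in>I. c k * c l * R k l) / 2))"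
  using centered_gaussian_char[OF prob_space_axioms gaussian mean_sum, of c] expectation_sum_sq[of c]
  by simp

abbreviation N where "N \<equiv> std_normal_distribution"

text \<open>
  The residuals \<open>Y l - R j l * Y j\<close> are uncorrelated with \<open>Y j\<close>, hence jointly independent of it.
  This is expressed by saying that \<open>Y j\<close>, in the decomposition of \<open>Y\<close> into residuals and
  multiples of \<open>Y j\<close>, may be replaced by a standard normal coordinate \<open>snd p\<close> on a product space.
\<close>

lemma law_by_regression:
  assumes j: "j \<in> I"
  shows "distr M (PiM I (\<lambda>_. borel)) (\<lambda>\<omega>. \<lambda>l\<in>I. Y l \<omega>) =
    distr (M \<Otimes>\<^sub>M N) (PiM I (\<lambda>_. borel)) (\<lambda>p. \<lambda>l\<in>I. Y l (fst p) - R j l * Y j (fst p) + R j l * snd p)"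
proof -
  interpret N: prob_space N by (rule prob_space_normal_density) simp
  interpret MN: pair_prob_space M N ..
  show ?thesis
  proof (rule joint_law_unique)
    fix c
    define r where "r = (\<Sum>l\<in>I. c l * R j l)"
    define d where "d l = c l - (if l = j then r else 0)" for l
    have split: "(\<Sum>l\<in>I. c l * (Y l \<omega> - R j l * Y j \<omega> + R j l * x)) = (\<Sum>l\<in>I. d l * Y l \<omega>) + r * x" for \<omega> x
      unfolding d_def using j sum_single[of j r "\<lambda>l. Y l \<omega>"]
      by (simp add: r_def left_diff_distrib sum_subtractf distrib_left sum.distrib right_diff_distrib
          sum_distrib_right sum_distrib_left mult_ac)
    have quad: "(\<Sum>k\<in>I. \<Sum>l\<in>I. d k * d l * R k l) = (\<Sum>k\<in>I. \<Sum>l\<in>I. c k * c l * R k l) - r\<^sup>2"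
    proof -
      have "(\<Sum>k\<in>I. \<Sum>l\<in>I. d k * d l * R k l) =
        (\<Sum>k\<in>I. \<Sum>l\<in>I. c k * c l * R k l) - (\<Sum>k\<in>I. \<Sum>l\<in>I. c k * ((if l = j then r else 0) * R k l))
         - (\<Sum>k\<in>I. (if k = j then r else 0) * (\<Sum>l\<in>I. c l * R k l))
         + (\<Sum>k\<in>I. (if k = j then r else 0) * (\<Sum>l\<in>I. (if l = j then r else 0) * R k l))"
        unfolding d_def by (simp add: algebra_simps sum_subtractf sum.distrib sum_distrib_left)
      also have "(\<Sum>k\<in>I. \<Sum>l\<in>I. c k * ((if l = j then r else 0) * R k l)) = r * r"
        by (simp add: sum_distrib_left[symmetric] sum_single[OF j] R_commute[of _ j])
          (simp add: r_def sum_distrib_left sum_distrib_right mult_ac)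
      also have "(\<Sum>k\<in>I. (if k = j then r else 0) * (\<Sum>l\<in>I. c l * R k l)) = r * r"
        by (simp add: sum_single[OF j] r_def)
      also have "(\<Sum>k\<in>I. (if k = j then r else 0) * (\<Sum>l\<in>I. (if l = j then r else 0) * R k l)) = r * r"
        by (simp add: sum_single[OF j] R_diag[OF j])
      finally show ?thesis by (simp add: power2_eq_square)
    qed
    have [measurable]: "(\<lambda>\<omega>. \<Sum>l\<in>I. d l * Y l \<omega>) \<in> borel_measurable M"
      by (auto intro!: borel_measurable_sum borel_measurable_times)
    have int: "integrable (M \<Otimes>\<^sub>M N) (\<lambda>p. iexp ((\<Sum>l\<in>I. d l * Y l (fst p)) + r * snd p))"
      by (intro MN.P.integrable_const_bound[of _ 1]) (auto simp del: of_real_sum of_real_add)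
    have "(\<integral>p. iexp (\<Sum>l\<in>I. c l * (Y l (fst p) - R j l * Y j (fst p) + R j l * snd p)) \<partial>(M \<Otimes>\<^sub>M N)) =
      (\<integral>\<omega>. \<integral>x. iexp ((\<Sum>l\<in>I. d l * Y l \<omega>) + r * x) \<partial>N \<partial>M)"
      unfolding split using MN.integral_fst'[OF int] by simp
    also have "\<dots> = (\<integral>\<omega>. iexp (\<Sum>l\<in>I. d l * Y l \<omega>) * char N r \<partial>M)"
      by (simp add: char_def distrib_left exp_add del: of_real_sum)
    also have "\<dots> = of_real (exp (- (\<Sum>k\<in>I. \<Sum>l\<in>I. d k * d l * R k l) / 2)) * of_real (exp (- r\<^sup>2 / 2))"
      by (simp add: characteristic_function char_std_normal_distribution del: of_real_sum)
    also have "\<dots> = of_real (exp (- (\<Sum>k\<in>I. \<Sum>l\<in>I. c k * c l * R k l) / 2))"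
      unfolding quad by (simp flip: of_real_mult exp_add add: field_simps)
    finally show "expectation (\<lambda>\<omega>. iexp (\<Sum>l\<in>I. c l * Y l \<omega>)) =
      (\<integral>p. iexp (\<Sum>l\<in>I. c l * (Y l (fst p) - R j l * Y j (fst p) + R j l * snd p)) \<partial>(M \<Otimes>\<^sub>M N))"
      by (simp only: characteristic_function)
  next
    fix l assume "l \<in> I"
    with j show "(\<lambda>p. Y l (fst p) - R j l * Y j (fst p) + R j l * snd p) \<in> borel_measurable (M \<Otimes>\<^sub>M N)"
      by measurable
  qed (auto intro: prob_space_axioms MN.P.prob_space_axioms finite_I)
qed

text \<open>
  The points of the product space are functions restricted to \<open>I\<close>; the hypothesis on \<open>restrict\<close>
  lets \<open>H\<close> be evaluated at unrestricted functions.
\<close>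

lemma
  fixes H :: "('i \<Rightarrow> real) \<Rightarrow> complex"
  assumes j: "j \<in> I" and [measurable]: "H \<in> borel_measurable (PiM I (\<lambda>_. borel))"
    and H: "\<And>y. H (restrict y I) = H y"
  shows integral_by_regression: "expectation (\<lambda>\<omega>. H (\<lambda>l. Y l \<omega>)) =
      (\<integral>p. H (\<lambda>l. Y l (fst p) - R j l * Y j (fst p) + R j l * snd p) \<partial>(M \<Otimes>\<^sub>M N))"
    and integrable_by_regression: "integrable M (\<lambda>\<omega>. H (\<lambda>l. Y l \<omega>)) \<longleftrightarrow>
      integrable (M \<Otimes>\<^sub>M N) (\<lambda>p. H (\<lambda>l. Y l (fst p) - R j l * Y j (fst p) + R j l * snd p))"
proof -
  let ?P = "PiM I (\<lambda>_. borel :: real measure)"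
  have [measurable]: "(\<lambda>\<omega>. \<lambda>l\<in>I. Y l \<omega>) \<in> measurable M ?P"
    "(\<lambda>p. \<lambda>l\<in>I. Y l (fst p) - R j l * Y j (fst p) + R j l * snd p) \<in> measurable (M \<Otimes>\<^sub>M N) ?P"
    by (intro measurable_restrict, use j in measurable)+
  show "expectation (\<lambda>\<omega>. H (\<lambda>l. Y l \<omega>)) =
      (\<integral>p. H (\<lambda>l. Y l (fst p) - R j l * Y j (fst p) + R j l * snd p) \<partial>(M \<Otimes>\<^sub>M N))"
    using arg_cong[OF law_by_regression[OF j], of "\<lambda>\<mu>. integral\<^sup>L \<mu> H"]
    by (simp add: integral_distr H)
  show "integrable M (\<lambda>\<omega>. H (\<lambda>l. Y l \<omega>)) \<longleftrightarrow>
      integrable (M \<Otimes>\<^sub>M N) (\<lambda>p. H (\<lambda>l. Y l (fst p) - R j l * Y j (fst p) + R j l * snd p))"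
    using arg_cong[OF law_by_regression[OF j], of "\<lambda>\<mu>. integrable \<mu> H"]
    by (simp add: integrable_distr_eq H)
qed

text \<open>
  The diagonal quadratic form of \<open>Y\<close> with coefficients \<open>w\<close>, centered at its mean: an element of
  the second Wiener chaos.
\<close>

definition Q :: "('i \<Rightarrow> real) \<Rightarrow> 'a \<Rightarrow> real" where
  "Q w \<omega> = (\<Sum>l\<in>I. w l * ((Y l \<omega>)\<^sup>2 - 1))"

lemma measurable_Q[measurable]: "Q w \<in> borel_measurable M"
  unfolding Q_def by (auto intro!: borel_measurable_sum borel_measurable_times borel_measurable_diff borel_measurable_power)

lemma integrable_mult_Y_iexp:
  "k \<in> I \<Longrightarrow> l \<in> I \<Longrightarrow> integrable M (\<lambda>\<omega>. of_real (Y k \<omega> * Y l \<omega>) * iexp (Q w \<omega>))"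
  by (rule Bochner_Integration.integrable_bound[OF integrable_mult_Y[of k l]])
    (auto simp: norm_mult abs_mult)

text \<open>
  After the regression on \<open>Y j\<close> the factor \<open>Y j\<close> is an independent standard normal variable \<open>x\<close>, and
  \<open>Y p\<close> has derivative \<open>R j p\<close> with respect to \<open>x\<close>.  One-dimensional integration by parts in \<open>x\<close>
  therefore produces \<open>R j k\<close> from the factor \<open>Y k\<close> and the sum over \<open>p\<close> from \<open>exp (i Q)\<close>.
\<close>

lemma gaussian_integration_by_parts:
  assumes j: "j \<in> I" and k: "k \<in> I"
  shows "expectation (\<lambda>\<omega>. of_real (Y j \<omega> * Y k \<omega>) * iexp (Q w \<omega>)) =
    of_real (R j k) * expectation (\<lambda>\<omega>. iexp (Q w \<omega>)) +
    2 * \<i> * (\<Sum>p\<in>I. of_real (w p * R j p) * expectation (\<lambda>\<omega>. of_real (Y k \<omega> * Y p \<omega>) * iexp (Q w \<omega>)))"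
proof -
  interpret N: prob_space N by (rule prob_space_normal_density) simp
  interpret MN: pair_prob_space M N ..
  define q where "q y = (\<Sum>l\<in>I. w l * ((y l)\<^sup>2 - 1))" for y :: "'i \<Rightarrow> real"
  define H1 where "H1 y = of_real (y j * y k) * iexp (q y)" for y :: "'i \<Rightarrow> real"
  \<comment> \<open>The derivative with respect to \<open>x\<close> of the factor of \<open>Y j\<close>, as a function of the vector.\<close>
  define F where "F y = of_real (R j k) * iexp (q y) +
    2 * \<i> * (\<Sum>p\<in>I. of_real (w p * R j p) * (of_real (y k * y p) * iexp (q y)))" for y :: "'i \<Rightarrow> real"
  \<comment> \<open>The vector rebuilt from the residuals at \<open>\<omega>\<close> and the new value \<open>x\<close> of coordinate \<open>j\<close>.\<close>
  define z where "z \<omega> x l = Y l \<omega> - R j l * Y j \<omega> + R j l * x" for \<omega> x l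
  have q_Y: "q (\<lambda>l. Y l \<omega>) = Q w \<omega>" for \<omega>
    by (simp add: q_def Q_def)
  have [measurable]: "q \<in> borel_measurable (PiM I (\<lambda>_. borel))"
    unfolding q_def[abs_def] by measurable
  have H1_m: "H1 \<in> borel_measurable (PiM I (\<lambda>_. borel))" and F_m: "F \<in> borel_measurable (PiM I (\<lambda>_. borel))"
    unfolding H1_def[abs_def] F_def[abs_def] using j k by measurable
  have q_r: "q (restrict y I) = q y" for y by (simp add: q_def)
  have H1_r: "H1 (restrict y I) = H1 y" and F_r: "F (restrict y I) = F y" for y
    using j k by (simp_all add: H1_def F_def q_r)
  have H1_i: "integrable M (\<lambda>\<omega>. H1 (\<lambda>l. Y l \<omega>))"
    using integrable_mult_Y_iexp[OF j k, of w] by (simp add: H1_def q_Y)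
  have F_i: "integrable M (\<lambda>\<omega>. F (\<lambda>l. Y l \<omega>))"
    unfolding F_def q_Y using k
    by (intro Bochner_Integration.integrable_add integrable_mult_right Bochner_Integration.integrable_sum integrable_mult_Y_iexp)
      (auto intro!: integrable_iexp)
  have H1_z: "integrable (M \<Otimes>\<^sub>M N) (\<lambda>p. H1 (z (fst p) (snd p)))"
    using H1_i integrable_by_regression[OF j H1_m H1_r] by (simp add: z_def[abs_def])
  have F_z: "integrable (M \<Otimes>\<^sub>M N) (\<lambda>p. F (z (fst p) (snd p)))"
    using F_i integrable_by_regression[OF j F_m F_r] by (simp add: z_def[abs_def])
  have inner: "(\<integral>x. H1 (z \<omega> x) \<partial>N) = (\<integral>x. F (z \<omega> x) \<partial>N)"
    if i: "integrable N (\<lambda>x. H1 (z \<omega> x))" "integrable N (\<lambda>x. F (z \<omega> x))" for \<omega>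
  proof -
    define G where "G x = of_real (z \<omega> x k) * iexp (q (z \<omega> x))" for x
    have zj: "z \<omega> x j = x" for x by (simp add: z_def R_diag[OF j])
    have H1_G: "H1 (z \<omega> x) = of_real x * G x" for x by (simp add: H1_def G_def zj)
    have dz: "((\<lambda>x. z \<omega> x l) has_real_derivative R j l) (at x)" for l x
      unfolding z_def by (auto intro!: derivative_eq_intros)
    have dq: "((\<lambda>x. q (z \<omega> x)) has_real_derivative (\<Sum>l\<in>I. w l * (2 * z \<omega> x l * R j l))) (at x)" for x
      unfolding q_def by (auto intro!: derivative_eq_intros dz sum.cong)
    have de: "((\<lambda>x. iexp (q (z \<omega> x))) has_vector_derivative
        (\<Sum>l\<in>I. w l * (2 * z \<omega> x l * R j l)) *\<^sub>R (\<i> * iexp (q (z \<omega> x)))) (at x)" for x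
      using vector_diff_chain_at[OF dq[unfolded has_real_derivative_iff_has_vector_derivative] has_vector_derivative_iexp, of x]
      by (simp add: o_def)
    have dG: "(G has_vector_derivative F (z \<omega> x)) (at x)" for x
    proof -
      have "((\<lambda>x. z \<omega> x k *\<^sub>R iexp (q (z \<omega> x))) has_vector_derivative
        z \<omega> x k *\<^sub>R ((\<Sum>l\<in>I. w l * (2 * z \<omega> x l * R j l)) *\<^sub>R (\<i> * iexp (q (z \<omega> x)))) + R j k *\<^sub>R iexp (q (z \<omega> x))) (at x)"
        by (rule has_vector_derivative_scaleR[OF dz de])
      also have "z \<omega> x k *\<^sub>R ((\<Sum>l\<in>I. w l * (2 * z \<omega> x l * R j l)) *\<^sub>R (\<i> * iexp (q (z \<omega> x)))) + R j k *\<^sub>R iexp (q (z \<omega> x)) = F (z \<omega> x)"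
        unfolding F_def by (simp add: scaleR_conv_of_real sum_distrib_left sum_distrib_right mult_ac)
      finally show ?thesis by (simp add: G_def[abs_def] scaleR_conv_of_real)
    qed
    have cz: "continuous_on UNIV (\<lambda>x. z \<omega> x l)" for l
      unfolding z_def by (intro continuous_intros)
    have cont: "continuous_on UNIV (\<lambda>x. F (z \<omega> x))"
      unfolding F_def q_def by (intro continuous_intros cz)
    have bound: "norm (G x) \<le> \<bar>Y k \<omega> - R j k * Y j \<omega>\<bar> + \<bar>R j k\<bar> * \<bar>x\<bar>" for x
      unfolding G_def z_def using abs_triangle_ineq[of "Y k \<omega> - R j k * Y j \<omega>" "R j k * x"]
      by (simp add: norm_mult abs_mult del: of_real_add of_real_diff of_real_mult)
    show ?thesis
      using std_normal_integration_by_parts[OF dG cont bound] i by (simp add: H1_G)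
  qed
  have AE1: "AE \<omega> in M. integrable N (\<lambda>x. H1 (z \<omega> x))"
    using MN.AE_integrable_fst'[OF H1_z] by simp
  have AE2: "AE \<omega> in M. integrable N (\<lambda>x. F (z \<omega> x))"
    using MN.AE_integrable_fst'[OF F_z] by simp
  have "expectation (\<lambda>\<omega>. H1 (\<lambda>l. Y l \<omega>)) = (\<integral>\<omega>. \<integral>x. H1 (z \<omega> x) \<partial>N \<partial>M)"
    using integral_by_regression[OF j H1_m H1_r] MN.integral_fst'[OF H1_z] by (simp add: z_def[abs_def])
  also have "\<dots> = (\<integral>\<omega>. \<integral>x. F (z \<omega> x) \<partial>N \<partial>M)"
  proof (rule integral_cong_AE)
    show "(\<lambda>\<omega>. \<integral>x. H1 (z \<omega> x) \<partial>N) \<in> borel_measurable M"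
      using MN.integrable_fst'[OF H1_z] by auto
    show "(\<lambda>\<omega>. \<integral>x. F (z \<omega> x) \<partial>N) \<in> borel_measurable M"
      using MN.integrable_fst'[OF F_z] by auto
    show "AE \<omega> in M. (\<integral>x. H1 (z \<omega> x) \<partial>N) = (\<integral>x. F (z \<omega> x) \<partial>N)"
      using AE1 AE2 by eventually_elim (rule inner)
  qed
  also have "\<dots> = expectation (\<lambda>\<omega>. F (\<lambda>l. Y l \<omega>))"
    using integral_by_regression[OF j F_m F_r] MN.integral_fst'[OF F_z] by (simp add: z_def[abs_def])
  also have "\<dots> = of_real (R j k) * expectation (\<lambda>\<omega>. iexp (Q w \<omega>)) +
    2 * \<i> * (\<Sum>p\<in>I. of_real (w p * R j p) * expectation (\<lambda>\<omega>. of_real (Y k \<omega> * Y p \<omega>) * iexp (Q w \<omega>)))"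
  proof -
    have "integrable M (\<lambda>\<omega>. iexp (Q w \<omega>))"
      by (rule integrable_iexp) auto
    then show ?thesis
      unfolding F_def q_Y using integrable_mult_Y_iexp[OF k, of _ w]
      by (simp del: of_real_mult add: Bochner_Integration.integrable_sum Bochner_Integration.integral_sum)
  qed
  finally show ?thesis by (simp add: H1_def q_Y)
qed

text \<open>
  By polarization, \<open>x\<^sup>2 * y\<^sup>2\<close> is a combination of the fourth powers of \<open>x + y\<close>, \<open>x - y\<close>, \<open>x\<close>
  and \<open>y\<close>, all of which are centered Gaussian here.
\<close>

lemma pair_moment:
  assumes k: "k \<in> I" and l: "l \<in> I"
  shows "integrable M (\<lambda>\<omega>. (Y k \<omega>)\<^sup>2 * (Y l \<omega>)\<^sup>2)"
    and "expectation (\<lambda>\<omega>. (Y k \<omega>)\<^sup>2 * (Y l \<omega>)\<^sup>2) = 1 + 2 * (R k l)\<^sup>2"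
proof -
  have comb: "(\<Sum>i\<in>I. ((if i = k then 1 else 0) + (if i = l then s else 0)) * Y i \<omega>) = Y k \<omega> + s * Y l \<omega>" for s \<omega>
    using sum_single[OF k, of 1] sum_single[OF l, of s] by (simp add: distrib_right sum.distrib)
  have g: "gaussian_rv M (\<lambda>\<omega>. Y k \<omega> + s * Y l \<omega>)" for s
    using gaussian[of "\<lambda>i. (if i = k then 1 else 0) + (if i = l then s else 0)"] by (simp only: comb)
  have mean: "expectation (\<lambda>\<omega>. Y k \<omega> + s * Y l \<omega>) = 0" for s
    using k l by (simp add: integrable_Y mean_zero)
  note i4 = centered_gaussian_power_integrable[OF prob_space_axioms g mean, of _ 4]
  have e2: "expectation (\<lambda>\<omega>. (Y k \<omega> + s * Y l \<omega>)\<^sup>2) = 1 + 2 * s * R k l + s\<^sup>2" for s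
  proof -
    have "expectation (\<lambda>\<omega>. (Y k \<omega> + s * Y l \<omega>)\<^sup>2) = expectation (\<lambda>\<omega>. (Y k \<omega>)\<^sup>2 + 2 * s * (Y k \<omega> * Y l \<omega>) + s\<^sup>2 * (Y l \<omega>)\<^sup>2)"
      by (intro Bochner_Integration.integral_cong refl) (simp add: power2_eq_square algebra_simps)
    also have "\<dots> = 1 + 2 * s * R k l + s\<^sup>2"
      using k l by (simp add: integrable_power integrable_mult_Y unit_variance R_def)
    finally show ?thesis .
  qed
  note e4 = centered_gaussian_fourth_moment[OF prob_space_axioms g mean, unfolded e2]
  have eY: "expectation (\<lambda>\<omega>. Y i \<omega> ^ 4) = 3" if "i \<in> I" for i
    using centered_gaussian_fourth_moment[OF prob_space_axioms gaussian_component mean_zero] that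
    by (simp add: unit_variance)
  have pol: "(Y k \<omega>)\<^sup>2 * (Y l \<omega>)\<^sup>2 = ((Y k \<omega> + 1 * Y l \<omega>) ^ 4 + (Y k \<omega> + (-1) * Y l \<omega>) ^ 4 - 2 * Y k \<omega> ^ 4 - 2 * Y l \<omega> ^ 4) / 12" for \<omega>
    by (simp add: field_simps power2_eq_square power4_eq_xxxx)
  show "integrable M (\<lambda>\<omega>. (Y k \<omega>)\<^sup>2 * (Y l \<omega>)\<^sup>2)"
    unfolding pol by (intro integrable_divide Bochner_Integration.integrable_diff Bochner_Integration.integrable_add integrable_mult_right i4 integrable_power k l)
  have "expectation (\<lambda>\<omega>. (Y k \<omega>)\<^sup>2 * (Y l \<omega>)\<^sup>2) =
     (3 * (1 + 2 * 1 * R k l + 1\<^sup>2)\<^sup>2 + 3 * (1 + 2 * (-1) * R k l + (-1)\<^sup>2)\<^sup>2 - 2 * 3 - 2 * 3) / 12"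
    unfolding pol e4[symmetric] using eY k l i4[of 1] i4[of "-1"] by (simp add: integrable_power)
  then show "expectation (\<lambda>\<omega>. (Y k \<omega>)\<^sup>2 * (Y l \<omega>)\<^sup>2) = 1 + 2 * (R k l)\<^sup>2"
    by (simp add: power2_eq_square field_simps)
qed

lemma pair_moment_centered:
  assumes k: "k \<in> I" and l: "l \<in> I"
  shows "integrable M (\<lambda>\<omega>. ((Y k \<omega>)\<^sup>2 - 1) * ((Y l \<omega>)\<^sup>2 - 1))"
    and "expectation (\<lambda>\<omega>. ((Y k \<omega>)\<^sup>2 - 1) * ((Y l \<omega>)\<^sup>2 - 1)) = 2 * (R k l)\<^sup>2"
proof -
  have e: "((Y k \<omega>)\<^sup>2 - 1) * ((Y l \<omega>)\<^sup>2 - 1) = (Y k \<omega>)\<^sup>2 * (Y l \<omega>)\<^sup>2 - (Y k \<omega>)\<^sup>2 - (Y l \<omega>)\<^sup>2 + 1" for \<omega>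
    by (simp add: algebra_simps)
  show "integrable M (\<lambda>\<omega>. ((Y k \<omega>)\<^sup>2 - 1) * ((Y l \<omega>)\<^sup>2 - 1))"
    unfolding e by (intro Bochner_Integration.integrable_diff Bochner_Integration.integrable_add pair_moment integrable_power k l) simp
  show "expectation (\<lambda>\<omega>. ((Y k \<omega>)\<^sup>2 - 1) * ((Y l \<omega>)\<^sup>2 - 1)) = 2 * (R k l)\<^sup>2"
    unfolding e using k l by (simp add: pair_moment integrable_power unit_variance prob_space)
qed

lemma Q_sq: "(Q w \<omega>)\<^sup>2 = (\<Sum>k\<in>I. \<Sum>l\<in>I. w k * w l * (((Y k \<omega>)\<^sup>2 - 1) * ((Y l \<omega>)\<^sup>2 - 1)))"
  unfolding Q_def power2_eq_square[of "sum _ _"] sum_product by (simp add: mult_ac)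

lemma integrable_Q_sq: "integrable M (\<lambda>\<omega>. (Q w \<omega>)\<^sup>2)"
  unfolding Q_sq by (intro Bochner_Integration.integrable_sum integrable_mult_right pair_moment_centered)

lemma variance_Q: "expectation (\<lambda>\<omega>. (Q w \<omega>)\<^sup>2) = 2 * (\<Sum>k\<in>I. \<Sum>l\<in>I. w k * w l * (R k l)\<^sup>2)"
  unfolding Q_sq
  by (simp add: Bochner_Integration.integral_sum Bochner_Integration.integrable_sum pair_moment_centered
      sum_distrib_left mult_ac)

lemma integrable_Q: "integrable M (Q w)"
  unfolding Q_def by (intro Bochner_Integration.integrable_sum integrable_mult_right Bochner_Integration.integrable_diff integrable_power) auto

text \<open>
  For a positive semidefinite matrix, a bound \<open>K\<close> on the quadratic form is a bound on the operator
  norm: evaluate the nonnegative form at \<open>z - y / K\<close>, where \<open>y\<close> is the image of \<open>z\<close>.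
\<close>

lemma quadratic_form_operator_bound:
  assumes K: "0 < K" and form: "\<And>c. (\<Sum>k\<in>I. \<Sum>l\<in>I. c k * c l * R k l) \<le> K * (\<Sum>l\<in>I. (c l)\<^sup>2)"
  shows "(\<Sum>l\<in>I. (\<Sum>k\<in>I. z k * R k l)\<^sup>2) \<le> K\<^sup>2 * (\<Sum>l\<in>I. (z l)\<^sup>2)"
proof -
  define y where "y l = (\<Sum>k\<in>I. z k * R k l)" for l
  define s where "s = (\<Sum>l\<in>I. (y l)\<^sup>2)"
  have zy: "(\<Sum>k\<in>I. \<Sum>l\<in>I. z k * y l * R k l) = s"
    unfolding s_def power2_eq_square
    by (subst sum.swap) (simp add: y_def sum_distrib_left sum_distrib_right mult_ac)
  have yz: "(\<Sum>k\<in>I. \<Sum>l\<in>I. y k * z l * R k l) = s"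
    using zy by (subst (asm) sum.swap) (simp add: R_commute mult_ac)
  have "0 \<le> expectation (\<lambda>\<omega>. (\<Sum>k\<in>I. (z k - y k / K) * Y k \<omega>)\<^sup>2)"
    by simp
  also have "\<dots> = (\<Sum>k\<in>I. \<Sum>l\<in>I. (z k - y k / K) * (z l - y l / K) * R k l)"
    by (rule expectation_sum_sq)
  also have "\<dots> = (\<Sum>k\<in>I. \<Sum>l\<in>I. z k * z l * R k l) - (\<Sum>k\<in>I. \<Sum>l\<in>I. z k * y l * R k l) / K
     - (\<Sum>k\<in>I. \<Sum>l\<in>I. y k * z l * R k l) / K + (\<Sum>k\<in>I. \<Sum>l\<in>I. y k * y l * R k l) / K\<^sup>2"
    by (simp add: left_diff_distrib right_diff_distrib diff_divide_distrib sum_subtractf sum.distrib sum_divide_distrib power2_eq_square)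
  also have "\<dots> \<le> K * (\<Sum>l\<in>I. (z l)\<^sup>2) - s / K - s / K + K * s / K\<^sup>2"
    unfolding zy yz using form[of z] form[of y] K by (intro add_mono diff_mono divide_right_mono) (auto simp: s_def)
  also have "\<dots> = K * (\<Sum>l\<in>I. (z l)\<^sup>2) - s / K"
    using K by (simp add: power2_eq_square)
  finally show ?thesis
    using K unfolding s_def y_def by (simp add: field_simps power2_eq_square)
qed

text \<open>
  The first order Taylor remainder of \<open>exp (i h Q)\<close> is at most \<open>h\<^sup>2 * Q\<^sup>2\<close>, which is integrable.
\<close>

lemma characteristic_function_has_derivative:
  "((\<lambda>t. expectation (\<lambda>\<omega>. iexp (t * Q w \<omega>))) has_vector_derivative
     expectation (\<lambda>\<omega>. \<i> * of_real (Q w \<omega>) * iexp (t * Q w \<omega>))) (at t)"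
proof -
  let ?f = "\<lambda>t. expectation (\<lambda>\<omega>. iexp (t * Q w \<omega>))"
  let ?D = "expectation (\<lambda>\<omega>. \<i> * of_real (Q w \<omega>) * iexp (t * Q w \<omega>))"
  let ?V = "expectation (\<lambda>\<omega>. (Q w \<omega>)\<^sup>2)"
  have i1: "integrable M (\<lambda>\<omega>. iexp (s * Q w \<omega>))" for s
    by (rule integrable_iexp) auto
  have i2: "integrable M (\<lambda>\<omega>. \<i> * of_real (Q w \<omega>) * iexp (t * Q w \<omega>))"
    by (rule Bochner_Integration.integrable_bound[OF integrable_Q[of w]]) (auto simp: norm_mult)
  have bound: "norm (?f (t + h) - ?f t - h *\<^sub>R ?D) \<le> h\<^sup>2 * ?V" for h
  proof -
    have "?f (t + h) - ?f t - h *\<^sub>R ?D =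
      expectation (\<lambda>\<omega>. iexp ((t + h) * Q w \<omega>) - iexp (t * Q w \<omega>) - h *\<^sub>R (\<i> * of_real (Q w \<omega>) * iexp (t * Q w \<omega>)))"
      using i1[of "t + h"] i1[of t] i2 by (simp del: of_real_mult of_real_add)
    also have "norm \<dots> \<le> expectation (\<lambda>\<omega>. h\<^sup>2 * (Q w \<omega>)\<^sup>2)"
    proof (rule norm_integral_le)
      show "integrable M (\<lambda>\<omega>. iexp ((t + h) * Q w \<omega>) - iexp (t * Q w \<omega>) - h *\<^sub>R (\<i> * of_real (Q w \<omega>) * iexp (t * Q w \<omega>)))"
        by (intro Bochner_Integration.integrable_diff i1 integrable_scaleR_right i2)
      show "integrable M (\<lambda>\<omega>. h\<^sup>2 * (Q w \<omega>)\<^sup>2)"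
        using integrable_Q_sq by simp
      fix \<omega>
      let ?x = "h * Q w \<omega>"
      have "iexp ((t + h) * Q w \<omega>) - iexp (t * Q w \<omega>) - h *\<^sub>R (\<i> * of_real (Q w \<omega>) * iexp (t * Q w \<omega>))
         = iexp (t * Q w \<omega>) * (iexp ?x - (\<Sum>k\<le>1. (\<i> * ?x) ^ k / fact k))"
        by (simp add: algebra_simps exp_add scaleR_conv_of_real)
      also have "norm \<dots> = norm (iexp ?x - (\<Sum>k\<le>1. (\<i> * ?x) ^ k / fact k))"
        by (simp add: norm_mult del: of_real_mult)
      also have "\<dots> \<le> \<bar>?x\<bar> ^ Suc 1 / fact (Suc 1)"
        by (rule iexp_approx1)
      also have "\<dots> \<le> h\<^sup>2 * (Q w \<omega>)\<^sup>2"
        unfolding Suc_1 power2_abs fact_2 power_mult_distrib by simp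
      finally show "norm (iexp ((t + h) * Q w \<omega>) - iexp (t * Q w \<omega>) - h *\<^sub>R (\<i> * of_real (Q w \<omega>) * iexp (t * Q w \<omega>)))
        \<le> h\<^sup>2 * (Q w \<omega>)\<^sup>2" .
    qed
    finally show ?thesis by simp
  qed
  have "(\<lambda>h. norm (?f (t + h) - ?f t - h *\<^sub>R ?D) / norm h) \<midarrow>0\<rightarrow> 0"
  proof (rule Lim_null_comparison)
    show "\<forall>\<^sub>F h in at 0. norm (norm (?f (t + h) - ?f t - h *\<^sub>R ?D) / norm h) \<le> \<bar>h\<bar> * ?V"
    proof (rule eventually_at_filter[THEN iffD2, OF always_eventually], intro allI impI)
      fix h :: real assume "h \<noteq> 0"
      then show "norm (norm (?f (t + h) - ?f t - h *\<^sub>R ?D) / norm h) \<le> \<bar>h\<bar> * ?V"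
        using bound[of h] by (simp add: field_simps power2_eq_square abs_mult[symmetric])
    qed
    show "(\<lambda>h. \<bar>h\<bar> * ?V) \<midarrow>0\<rightarrow> 0"
      by (auto intro!: tendsto_eq_intros)
  qed
  then show ?thesis
    unfolding has_vector_derivative_def has_derivative_at by (simp add: bounded_linear_scaleR_left)
qed

text \<open>
  The quantitative central limit theorem for \<open>Q\<close>.  Integration by parts shows that
  \<open>\<phi> t = E exp (i t Q)\<close> solves \<open>\<phi>' t = - t * v * \<phi> t\<close>, the equation of \<open>exp (- v * t\<^sup>2 / 2)\<close>, up to an
  error of third order in the weights.  The error carries only one factor \<open>card I\<close> since the
  matrix \<open>R\<close> enters through its operator bound \<open>K\<close> and not entry by entry.
\<close>

lemma characteristic_function_quadratic_form:
  assumes K: "0 < K" and form: "\<And>c. (\<Sum>k\<in>I. \<Sum>l\<in>I. c k * c l * R k l) \<le> K * (\<Sum>l\<in>I. (c l)\<^sup>2)"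
    and w: "\<And>l. l \<in> I \<Longrightarrow> \<bar>w l\<bar> \<le> \<delta>" and "0 \<le> \<delta>"
  shows "norm (expectation (\<lambda>\<omega>. iexp (Q w \<omega>)) - of_real (exp (- expectation (\<lambda>\<omega>. (Q w \<omega>)\<^sup>2) / 2)))
    \<le> 4 * real (card I) * \<delta> ^ 3 * K\<^sup>2"
proof -
  define v where "v = expectation (\<lambda>\<omega>. (Q w \<omega>)\<^sup>2)"
  define B where "B = real (card I) * \<delta> ^ 3 * K\<^sup>2"
  define \<phi> where "\<phi> t = expectation (\<lambda>\<omega>. iexp (t * Q w \<omega>))" for t
  define \<phi>' where "\<phi>' t = expectation (\<lambda>\<omega>. \<i> * of_real (Q w \<omega>) * iexp (t * Q w \<omega>))" for t
  define m where "m t k l = expectation (\<lambda>\<omega>. of_real (Y k \<omega> * Y l \<omega>) * iexp (t * Q w \<omega>))" for t k l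
  \<comment> \<open>The defect in the differential equation of \<open>exp (- v * t\<^sup>2 / 2)\<close>.\<close>
  define \<epsilon> where "\<epsilon> t = \<phi>' t + of_real (t * v) * \<phi> t" for t
  have v0: "0 \<le> v" by (simp add: v_def)
  have Qt: "Q (\<lambda>l. t * w l) \<omega> = t * Q w \<omega>" for t \<omega>
    by (simp add: Q_def sum_distrib_left mult_ac)
  have im: "integrable M (\<lambda>\<omega>. of_real (Y k \<omega> * Y l \<omega>) * iexp (t * Q w \<omega>))" if "k \<in> I" "l \<in> I" for k l t
    using integrable_mult_Y_iexp[OF that, of "\<lambda>l. t * w l"] by (simp add: Qt)
  have ie: "integrable M (\<lambda>\<omega>. iexp (t * Q w \<omega>))" for t by (rule integrable_iexp) auto
  have m_eq: "m t j k = of_real (R j k) * \<phi> t + 2 * \<i> * of_real t * (\<Sum>p\<in>I. of_real (w p * R j p) * m t k p)"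
    if "j \<in> I" "k \<in> I" for t j k
    using gaussian_integration_by_parts[OF that, of "\<lambda>l. t * w l"]
    unfolding Qt m_def \<phi>_def by (simp add: sum_distrib_left mult_ac)
  have m_comm: "m t k l = m t l k" for t k l by (simp add: m_def mult_ac)
  \<comment> \<open>Integration by parts for \<open>m t k k\<close>, and again for each \<open>m t l k\<close> that appears; the middle
    term makes up \<open>- t * v * \<phi> t\<close>.\<close>
  have m_diag: "m t k k = \<phi> t + 2 * \<i> * of_real t * (\<Sum>l\<in>I. of_real (w l * (R k l)\<^sup>2)) * \<phi> t
      - 4 * of_real (t\<^sup>2) * (\<Sum>l\<in>I. \<Sum>p\<in>I. of_real (w l * R k l * (w p * R l p)) * m t k p)"
    if k: "k \<in> I" for t k
  proof -
    have "m t k k = \<phi> t + 2 * \<i> * of_real t * (\<Sum>l\<in>I. of_real (w l * R k l) * m t l k)"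
      using m_eq[OF k k, of t] unfolding R_diag[OF k] by (subst m_comm) simp
    also have "(\<Sum>l\<in>I. of_real (w l * R k l) * m t l k) = (\<Sum>l\<in>I. of_real (w l * R k l) *
      (of_real (R k l) * \<phi> t + 2 * \<i> * of_real t * (\<Sum>p\<in>I. of_real (w p * R l p) * m t k p)))"
      using k by (intro sum.cong refl) (simp add: m_eq R_commute)
    also have "\<dots> = (\<Sum>l\<in>I. of_real (w l * (R k l)\<^sup>2)) * \<phi> t + 2 * \<i> * of_real t *
       (\<Sum>l\<in>I. \<Sum>p\<in>I. of_real (w l * R k l * (w p * R l p)) * m t k p)"
      by (simp add: distrib_left sum.distrib sum_distrib_left sum_distrib_right power2_eq_square mult_ac)
    finally show ?thesis
      by (simp add: algebra_simps power2_eq_square)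
  qed
  have \<phi>'_eq: "\<phi>' t = \<i> * (\<Sum>k\<in>I. of_real (w k) * (m t k k - \<phi> t))" for t
  proof -
    have "\<phi>' t = expectation (\<lambda>\<omega>. \<i> * (\<Sum>k\<in>I. of_real (w k) * (of_real (Y k \<omega> * Y k \<omega>) * iexp (t * Q w \<omega>) - iexp (t * Q w \<omega>))))"
      unfolding \<phi>'_def by (intro Bochner_Integration.integral_cong refl, subst Q_def)
        (simp add: sum_distrib_right sum_distrib_left algebra_simps power2_eq_square)
    also have "\<dots> = \<i> * (\<Sum>k\<in>I. of_real (w k) * (m t k k - \<phi> t))"
      unfolding m_def \<phi>_def using im ie
      by (simp add: Bochner_Integration.integral_sum Bochner_Integration.integrable_sum del: of_real_mult)
    finally show ?thesis .
  qed
  \<comment> \<open>The triple sums add up to the form of \<open>W R W R W\<close> at \<open>Y\<close>, written as a weighted sum of squares.\<close>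
  have \<epsilon>_eq: "\<epsilon> t = - 4 * \<i> * of_real (t\<^sup>2) *
      expectation (\<lambda>\<omega>. of_real (\<Sum>l\<in>I. w l * (\<Sum>k\<in>I. (w k * Y k \<omega>) * R k l)\<^sup>2) * iexp (t * Q w \<omega>))" for t
  proof -
    have "\<phi>' t = \<i> * (\<Sum>k\<in>I. of_real (w k) * (2 * \<i> * of_real t * (\<Sum>l\<in>I. of_real (w l * (R k l)\<^sup>2)) * \<phi> t
      - 4 * of_real (t\<^sup>2) * (\<Sum>l\<in>I. \<Sum>p\<in>I. of_real (w l * R k l * (w p * R l p)) * m t k p)))"
      unfolding \<phi>'_eq by (simp add: m_diag)
    also have "\<dots> = - of_real (t * v) * \<phi> t - 4 * \<i> * of_real (t\<^sup>2) *
       (\<Sum>k\<in>I. \<Sum>l\<in>I. \<Sum>p\<in>I. of_real (w k * (w l * R k l * (w p * R l p))) * m t k p)"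
      unfolding v_def variance_Q
      by (simp add: algebra_simps sum_subtractf sum_negf sum_distrib_left sum_distrib_right)
    also have "(\<Sum>k\<in>I. \<Sum>l\<in>I. \<Sum>p\<in>I. of_real (w k * (w l * R k l * (w p * R l p))) * m t k p) =
      expectation (\<lambda>\<omega>. \<Sum>k\<in>I. \<Sum>l\<in>I. \<Sum>p\<in>I. of_real (w k * (w l * R k l * (w p * R l p))) * (of_real (Y k \<omega> * Y p \<omega>) * iexp (t * Q w \<omega>)))"
      unfolding m_def using im by (simp add: Bochner_Integration.integral_sum Bochner_Integration.integrable_sum del: of_real_mult)
    also have "\<dots> = expectation (\<lambda>\<omega>. of_real (\<Sum>l\<in>I. w l * (\<Sum>k\<in>I. (w k * Y k \<omega>) * R k l)\<^sup>2) * iexp (t * Q w \<omega>))"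
    proof (intro Bochner_Integration.integral_cong refl)
      fix \<omega>
      have "(\<Sum>l\<in>I. w l * (\<Sum>k\<in>I. (w k * Y k \<omega>) * R k l)\<^sup>2) =
        (\<Sum>l\<in>I. \<Sum>k\<in>I. \<Sum>p\<in>I. w k * (w l * R k l * (w p * R l p)) * (Y k \<omega> * Y p \<omega>))"
        unfolding power2_eq_square sum_product by (simp add: sum_distrib_left R_commute mult_ac)
      also have "\<dots> = (\<Sum>k\<in>I. \<Sum>l\<in>I. \<Sum>p\<in>I. w k * (w l * R k l * (w p * R l p)) * (Y k \<omega> * Y p \<omega>))"
        by (rule sum.swap)
      finally show "(\<Sum>k\<in>I. \<Sum>l\<in>I. \<Sum>p\<in>I. of_real (w k * (w l * R k l * (w p * R l p))) * (of_real (Y k \<omega> * Y p \<omega>) * iexp (t * Q w \<omega>))) =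
        of_real (\<Sum>l\<in>I. w l * (\<Sum>k\<in>I. (w k * Y k \<omega>) * R k l)\<^sup>2) * iexp (t * Q w \<omega>)"
        by (simp add: sum_distrib_right sum_distrib_left mult_ac)
    qed
    finally show ?thesis by (simp add: \<epsilon>_def)
  qed
  have \<epsilon>_le: "norm (\<epsilon> t) \<le> 4 * B" if t: "0 \<le> t" "t \<le> 1" for t
  proof -
    have pt: "\<bar>\<Sum>l\<in>I. w l * (\<Sum>k\<in>I. (w k * Y k \<omega>) * R k l)\<^sup>2\<bar> \<le> \<delta> * (K\<^sup>2 * (\<Sum>l\<in>I. \<delta>\<^sup>2 * (Y l \<omega>)\<^sup>2))" for \<omega>
    proof -
      have "\<bar>\<Sum>l\<in>I. w l * (\<Sum>k\<in>I. (w k * Y k \<omega>) * R k l)\<^sup>2\<bar> \<le> (\<Sum>l\<in>I. \<delta> * (\<Sum>k\<in>I. (w k * Y k \<omega>) * R k l)\<^sup>2)"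
        by (rule order_trans[OF sum_abs]) (auto intro!: sum_mono mult_right_mono w simp: abs_mult)
      also have "\<dots> \<le> \<delta> * (K\<^sup>2 * (\<Sum>l\<in>I. (w l * Y l \<omega>)\<^sup>2))"
        using quadratic_form_operator_bound[OF K form, of "\<lambda>k. w k * Y k \<omega>"] \<open>0 \<le> \<delta>\<close>
        unfolding sum_distrib_left[symmetric] by (intro mult_left_mono) auto
      also have "\<dots> \<le> \<delta> * (K\<^sup>2 * (\<Sum>l\<in>I. \<delta>\<^sup>2 * (Y l \<omega>)\<^sup>2))"
        using \<open>0 \<le> \<delta>\<close> w unfolding power_mult_distrib
        by (intro mult_left_mono sum_mono mult_right_mono) (auto intro: power2_le_iff_abs_le[THEN iffD2])
      finally show ?thesis .
    qed
    have "norm (expectation (\<lambda>\<omega>. of_real (\<Sum>l\<in>I. w l * (\<Sum>k\<in>I. (w k * Y k \<omega>) * R k l)\<^sup>2) * iexp (t * Q w \<omega>)))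
      \<le> expectation (\<lambda>\<omega>. \<delta> * (K\<^sup>2 * (\<Sum>l\<in>I. \<delta>\<^sup>2 * (Y l \<omega>)\<^sup>2)))"
    proof (rule norm_integral_le)
      show i: "integrable M (\<lambda>\<omega>. \<delta> * (K\<^sup>2 * (\<Sum>l\<in>I. \<delta>\<^sup>2 * (Y l \<omega>)\<^sup>2)))"
        by (intro integrable_mult_right Bochner_Integration.integrable_sum integrable_power)
      have [measurable]: "(\<lambda>\<omega>. \<Sum>l\<in>I. w l * (\<Sum>k\<in>I. (w k * Y k \<omega>) * R k l)\<^sup>2) \<in> borel_measurable M"
        by (intro borel_measurable_sum borel_measurable_times borel_measurable_power) auto
      show le: "norm (of_real (\<Sum>l\<in>I. w l * (\<Sum>k\<in>I. (w k * Y k \<omega>) * R k l)\<^sup>2) * iexp (t * Q w \<omega>)) \<le>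
        \<delta> * (K\<^sup>2 * (\<Sum>l\<in>I. \<delta>\<^sup>2 * (Y l \<omega>)\<^sup>2))" for \<omega>
        using pt[of \<omega>] by (simp add: norm_mult del: of_real_sum of_real_mult)
      show "integrable M (\<lambda>\<omega>. of_real (\<Sum>l\<in>I. w l * (\<Sum>k\<in>I. (w k * Y k \<omega>) * R k l)\<^sup>2) * iexp (t * Q w \<omega>))"
        by (rule Bochner_Integration.integrable_bound[OF i])
          (measurable, intro AE_I2 order_trans[OF le], simp only: real_norm_def abs_ge_self)
    qed
    also have "\<dots> = \<delta> * (K\<^sup>2 * (real (card I) * \<delta>\<^sup>2))"
      by (simp add: Bochner_Integration.integral_sum integrable_power unit_variance)
    also have "\<dots> = B"
      by (simp add: B_def power2_eq_square power3_eq_cube)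
    finally have "norm (\<epsilon> t) \<le> 4 * t\<^sup>2 * B"
      unfolding \<epsilon>_eq by (simp add: norm_mult mult_left_mono del: of_real_sum of_real_mult of_real_power)
    also have "\<dots> \<le> 4 * 1 * B"
      using t \<open>0 \<le> \<delta>\<close> by (intro mult_right_mono mult_left_mono) (auto simp: B_def power_le_one)
    finally show ?thesis by simp
  qed
  \<comment> \<open>The integrating factor reduces the equation to a mean value estimate on \<open>{0..1}\<close>.\<close>
  define f where "f t = exp (v * t\<^sup>2 / 2) *\<^sub>R \<phi> t" for t
  have f': "(f has_vector_derivative exp (v * t\<^sup>2 / 2) *\<^sub>R \<epsilon> t) (at t)" for t
  proof -
    have e: "((\<lambda>t. exp (v * t\<^sup>2 / 2)) has_real_derivative exp (v * t\<^sup>2 / 2) * (v * t)) (at t)"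
      by (auto intro!: derivative_eq_intros)
    have "(\<phi> has_vector_derivative \<phi>' t) (at t)"
      unfolding \<phi>_def \<phi>'_def by (rule characteristic_function_has_derivative)
    from has_vector_derivative_scaleR[OF e this] show ?thesis
      by (simp add: f_def[abs_def] \<epsilon>_def scaleR_conv_of_real algebra_simps)
  qed
  have "norm (f 1 - f 0) \<le> exp (v / 2) * (4 * B) * norm (1 - 0 :: real)"
  proof (rule differentiable_bound[of "{0..1}"])
    fix t :: real assume t: "t \<in> {0..1}"
    show "(f has_derivative (\<lambda>h. h *\<^sub>R (exp (v * t\<^sup>2 / 2) *\<^sub>R \<epsilon> t))) (at t within {0..1})"
      using f'[of t] by (auto simp: has_vector_derivative_def intro: has_derivative_at_withinI)
    have "v * t\<^sup>2 \<le> v" using t v0 by (intro mult_left_le) (auto simp: power_le_one)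
    then have le: "norm (exp (v * t\<^sup>2 / 2) *\<^sub>R \<epsilon> t) \<le> exp (v / 2) * (4 * B)"
      using \<epsilon>_le[of t] t by (auto intro!: mult_mono)
    show "onorm (\<lambda>h. h *\<^sub>R (exp (v * t\<^sup>2 / 2) *\<^sub>R \<epsilon> t)) \<le> exp (v / 2) * (4 * B)"
    proof (rule onorm_le)
      fix h :: real
      have "norm (h *\<^sub>R (exp (v * t\<^sup>2 / 2) *\<^sub>R \<epsilon> t)) = norm h * norm (exp (v * t\<^sup>2 / 2) *\<^sub>R \<epsilon> t)"
        by (simp add: abs_mult)
      also have "\<dots> \<le> norm h * (exp (v / 2) * (4 * B))"
        by (rule mult_left_mono[OF le norm_ge_zero])
      finally show "norm (h *\<^sub>R (exp (v * t\<^sup>2 / 2) *\<^sub>R \<epsilon> t)) \<le> exp (v / 2) * (4 * B) * norm h"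
        by (simp only: mult.commute)
    qed
  qed auto
  then have "norm (exp (v / 2) *\<^sub>R \<phi> 1 - 1) \<le> exp (v / 2) * (4 * B)"
    by (simp add: f_def \<phi>_def prob_space)
  moreover have "exp (v / 2) *\<^sub>R \<phi> 1 - 1 = exp (v / 2) *\<^sub>R (\<phi> 1 - of_real (exp (- v / 2)))"
    by (simp add: scaleR_conv_of_real right_diff_distrib flip: of_real_mult exp_add)
  ultimately have "norm (\<phi> 1 - of_real (exp (- v / 2))) \<le> 4 * B"
    by simp
  then show ?thesis by (simp add: \<phi>_def v_def B_def mult_ac)
qed

text \<open>
  The Schur test for a symmetric matrix: \<open>2 * \<bar>c k * c l\<bar> \<le> (c k)\<^sup>2 + (c l)\<^sup>2\<close>.
\<close>

lemma quadratic_form_le_row_sum: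
  assumes J: "J \<subseteq> I" and row: "\<And>k. k \<in> J \<Longrightarrow> (\<Sum>l\<in>J. \<bar>R k l\<bar>) \<le> C"
  shows "(\<Sum>k\<in>J. \<Sum>l\<in>J. c k * c l * R k l) \<le> C * (\<Sum>k\<in>J. (c k)\<^sup>2)"
proof -
  have "c k * c l * R k l \<le> (c k)\<^sup>2 * \<bar>R k l\<bar> / 2 + (c l)\<^sup>2 * \<bar>R l k\<bar> / 2" for k l
  proof -
    have "c k * c l * R k l \<le> \<bar>c k\<bar> * \<bar>c l\<bar> * \<bar>R k l\<bar>"
      by (metis abs_ge_self abs_mult)
    also have "\<dots> \<le> ((c k)\<^sup>2 + (c l)\<^sup>2) / 2 * \<bar>R k l\<bar>"
      using sum_squares_bound[of "\<bar>c k\<bar>" "\<bar>c l\<bar>"] by (intro mult_right_mono) auto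
    finally show ?thesis by (simp add: R_commute[of l k] field_simps)
  qed
  then have "(\<Sum>k\<in>J. \<Sum>l\<in>J. c k * c l * R k l) \<le>
    (\<Sum>k\<in>J. \<Sum>l\<in>J. (c k)\<^sup>2 * \<bar>R k l\<bar> / 2 + (c l)\<^sup>2 * \<bar>R l k\<bar> / 2)"
    by (intro sum_mono)
  also have "\<dots> = (\<Sum>k\<in>J. \<Sum>l\<in>J. (c k)\<^sup>2 * \<bar>R k l\<bar> / 2) + (\<Sum>k\<in>J. \<Sum>l\<in>J. (c l)\<^sup>2 * \<bar>R l k\<bar> / 2)"
    by (simp add: sum.distrib)
  also have "(\<Sum>k\<in>J. \<Sum>l\<in>J. (c l)\<^sup>2 * \<bar>R l k\<bar> / 2) = (\<Sum>k\<in>J. \<Sum>l\<in>J. (c k)\<^sup>2 * \<bar>R k l\<bar> / 2)"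
    by (rule sum.swap)
  also have "(\<Sum>k\<in>J. \<Sum>l\<in>J. (c k)\<^sup>2 * \<bar>R k l\<bar> / 2) + (\<Sum>k\<in>J. \<Sum>l\<in>J. (c k)\<^sup>2 * \<bar>R k l\<bar> / 2)
    = (\<Sum>k\<in>J. (c k)\<^sup>2 * (\<Sum>l\<in>J. \<bar>R k l\<bar>))"
    by (simp add: sum.distrib[symmetric] sum_distrib_left mult_ac)
  also have "\<dots> \<le> (\<Sum>k\<in>J. (c k)\<^sup>2 * C)"
    by (intro sum_mono mult_left_mono row) auto
  finally show ?thesis by (simp add: sum_distrib_left mult.commute)
qed

text \<open>
  Changing the sign of the coefficients on \<open>J'\<close> leaves the form nonnegative and changes the sign
  of the off-diagonal blocks; in the sum of the two values only the diagonal blocks remain, twice.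
\<close>

lemma quadratic_form_two_blocks:
  assumes J: "I = J \<union> J'" "J \<inter> J' = {}"
    and row: "\<And>k. k \<in> J \<Longrightarrow> (\<Sum>l\<in>J. \<bar>R k l\<bar>) \<le> C" "\<And>k. k \<in> J' \<Longrightarrow> (\<Sum>l\<in>J'. \<bar>R k l\<bar>) \<le> C"
  shows "(\<Sum>k\<in>I. \<Sum>l\<in>I. c k * c l * R k l) \<le> 2 * C * (\<Sum>k\<in>I. (c k)\<^sup>2)"
proof -
  have fin: "finite J" "finite J'" using finite_I J(1) by auto
  have split: "(\<Sum>k\<in>I. f k) = (\<Sum>k\<in>J. f k) + (\<Sum>k\<in>J'. f k)" for f :: "'i \<Rightarrow> real"
    unfolding J(1) by (rule sum.union_disjoint) (use fin J(2) in auto)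
  define q where "q A B = (\<Sum>k\<in>A. \<Sum>l\<in>B. c k * c l * R k l)" for A B
  define c' where "c' k = (if k \<in> J then c k else - c k)" for k
  have c': "k \<in> J \<Longrightarrow> c' k = c k" "k \<in> J' \<Longrightarrow> c' k = - c k" for k
    using J(2) by (auto simp: c'_def)
  have 1: "(\<Sum>k\<in>I. \<Sum>l\<in>I. c k * c l * R k l) = q J J + q J J' + q J' J + q J' J'"
    unfolding split q_def by (simp add: sum.distrib)
  have "0 \<le> expectation (\<lambda>\<omega>. (\<Sum>k\<in>I. c' k * Y k \<omega>)\<^sup>2)" by simp
  also have "\<dots> = (\<Sum>k\<in>I. \<Sum>l\<in>I. c' k * c' l * R k l)"
    by (rule expectation_sum_sq)
  also have "\<dots> = q J J - q J J' - q J' J + q J' J'"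
    unfolding split q_def
    by (simp add: sum.distrib c' sum_negf sum_subtractf cong: sum.cong)
  finally have "(\<Sum>k\<in>I. \<Sum>l\<in>I. c k * c l * R k l) \<le> 2 * q J J + 2 * q J' J'"
    unfolding 1 by linarith
  also have "\<dots> \<le> 2 * (C * (\<Sum>k\<in>J. (c k)\<^sup>2)) + 2 * (C * (\<Sum>k\<in>J'. (c k)\<^sup>2))"
    unfolding q_def using J(1) by (intro add_mono mult_left_mono quadratic_form_le_row_sum row) auto
  finally show ?thesis by (simp add: split distrib_left)
qed

end

section \<open>Levy continuity in Euclidean spaces\<close>

text \<open>
  The test functions whose expectations can be read off the characteristic function.
\<close>

inductive trig_poly :: "('b::euclidean_space \<Rightarrow> real) \<Rightarrow> bool" where
  cos: "trig_poly (\<lambda>x. r * cos (c \<bullet> x))"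
| sin: "trig_poly (\<lambda>x. r * sin (c \<bullet> x))"
| add: "trig_poly f \<Longrightarrow> trig_poly g \<Longrightarrow> trig_poly (\<lambda>x. f x + g x)"

lemma trig_poly_scale: "trig_poly f \<Longrightarrow> trig_poly (\<lambda>x. s * f x)"
proof (induction rule: trig_poly.induct)
  case (cos r c)
  then show ?case using trig_poly.cos[of "s * r" c] by (simp add: mult.assoc)
next
  case (sin r c)
  then show ?case using trig_poly.sin[of "s * r" c] by (simp add: mult.assoc)
next
  case (add f g)
  then show ?case by (auto simp: distrib_left intro: trig_poly.add)
qed

lemma trig_poly_mult:
  assumes "trig_poly f" "trig_poly g"
  shows "trig_poly (\<lambda>x. f x * g x)"
  using assms(1)
proof (induction rule: trig_poly.induct)
  case (cos r c)
  show ?case using assms(2)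
  proof (induction rule: trig_poly.induct)
    case (cos r' c')
    have eq: "r * cos (c \<bullet> x) * (r' * cos (c' \<bullet> x)) = r * r' / 2 * cos ((c - c') \<bullet> x) + r * r' / 2 * cos ((c + c') \<bullet> x)" for x
      by (simp add: inner_left_distrib inner_diff_left cos_add cos_diff field_simps)
    show ?case unfolding eq by (intro trig_poly.intros)
  next
    case (sin r' c')
    have eq: "r * cos (c \<bullet> x) * (r' * sin (c' \<bullet> x)) = r * r' / 2 * sin ((c' - c) \<bullet> x) + r * r' / 2 * sin ((c + c') \<bullet> x)" for x
      by (simp add: inner_left_distrib inner_diff_left sin_add sin_diff field_simps)
    show ?case unfolding eq by (intro trig_poly.intros)
  next
    case (add f g)
    then show ?case by (auto simp: distrib_left intro: trig_poly.add)
  qed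
next
  case (sin r c)
  show ?case using assms(2)
  proof (induction rule: trig_poly.induct)
    case (cos r' c')
    have eq: "r * sin (c \<bullet> x) * (r' * cos (c' \<bullet> x)) = r * r' / 2 * sin ((c - c') \<bullet> x) + r * r' / 2 * sin ((c + c') \<bullet> x)" for x
      by (simp add: inner_left_distrib inner_diff_left sin_add sin_diff field_simps)
    show ?case unfolding eq by (intro trig_poly.intros)
  next
    case (sin r' c')
    have eq: "r * sin (c \<bullet> x) * (r' * sin (c' \<bullet> x)) = r * r' / 2 * cos ((c - c') \<bullet> x) + (- (r * r' / 2)) * cos ((c + c') \<bullet> x)" for x
      by (simp add: inner_left_distrib inner_diff_left cos_add cos_diff field_simps)
    show ?case unfolding eq by (intro trig_poly.intros)
  next
    case (add f g)
    then show ?case by (auto simp: distrib_left intro: trig_poly.add)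
  qed
next
  case (add f1 f2)
  then show ?case by (auto simp: distrib_right intro: trig_poly.add)
qed

lemma trig_poly_const: "trig_poly (\<lambda>x. r)"
  using trig_poly.cos[of r 0] by simp

lemma trig_poly_sum:
  assumes "finite A" "\<And>i. i \<in> A \<Longrightarrow> trig_poly (f i)"
  shows "trig_poly (\<lambda>x. \<Sum>i\<in>A. f i x)"
  using assms by (induction rule: finite_induct) (auto intro: trig_poly_const trig_poly.add)

lemma trig_poly_compose_real_polynomial:
  fixes s :: "'b::euclidean_space \<Rightarrow> 'b"
  assumes "real_polynomial_function p" and "\<And>b. b \<in> Basis \<Longrightarrow> trig_poly (\<lambda>x. s x \<bullet> b)"
  shows "trig_poly (\<lambda>x. p (s x))"
  using assms(1)
proof (induction rule: real_polynomial_function.induct)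
  case (linear f)
  then interpret bounded_linear f .
  have "f (s x) = (\<Sum>b\<in>Basis. f b * (s x \<bullet> b))" for x
  proof -
    have "f (s x) = f (\<Sum>b\<in>Basis. (s x \<bullet> b) *\<^sub>R b)" by (simp add: euclidean_representation)
    then show ?thesis by (simp add: sum scaleR mult.commute)
  qed
  then show ?case using assms(2) by (auto intro!: trig_poly_sum trig_poly_scale)
qed (auto intro: trig_poly_const trig_poly.add trig_poly_mult)

text \<open>
  On the ball of radius \<open>L\<close> one can recover \<open>x\<close> from the sines of its scaled coordinates
  \<open>(x \<bullet> b) / L\<close>.  So \<open>f\<close> agrees there with a continuous function on the cube \<open>[-1, 1]^d\<close>, evaluated at
  these sines; a polynomial close to that function gives a trigonometric polynomial which is close
  to \<open>f\<close> on the ball and, since sines stay in the cube, bounded on the whole space.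
\<close>

lemma trig_poly_approximation:
  fixes f :: "'b::euclidean_space \<Rightarrow> real"
  assumes f: "continuous_on UNIV f" "\<And>x. \<bar>f x\<bar> \<le> B" and L: "0 < L" and e: "0 < e"
  obtains p where "trig_poly p" "\<And>x. norm x \<le> L \<Longrightarrow> \<bar>f x - p x\<bar> \<le> e" "\<And>x. \<bar>p x\<bar> \<le> B + e"
proof -
  define A where "A y = (\<Sum>b\<in>Basis. (L * arcsin (y \<bullet> b)) *\<^sub>R b)" for y :: 'b
  define s where "s x = (\<Sum>b\<in>Basis. sin ((x \<bullet> b) / L) *\<^sub>R b)" for x :: 'b
  let ?K = "cbox (-One) One :: 'b set"
  have sb: "s x \<bullet> b = sin ((x \<bullet> b) / L)" if "b \<in> Basis" for x b
    using that by (simp add: s_def)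
  have sK: "s x \<in> ?K" for x by (simp add: mem_box sb)
  have "continuous_on ?K A"
    unfolding A_def by (intro continuous_intros) (auto simp: mem_box)
  then have "continuous_on ?K (\<lambda>y. f (A y))"
    by (rule continuous_on_compose2[OF f(1)]) auto
  then obtain q where q: "real_polynomial_function q" "\<And>y. y \<in> ?K \<Longrightarrow> \<bar>f (A y) - q y\<bar> < e"
    using Stone_Weierstrass_real_polynomial_function[OF compact_cbox _ e] by blast
  show ?thesis
  proof (rule that)
    show "trig_poly (\<lambda>x. q (s x))"
    proof (rule trig_poly_compose_real_polynomial[OF q(1)])
      fix b :: 'b assume "b \<in> Basis"
      then have "s x \<bullet> b = 1 * sin ((b /\<^sub>R L) \<bullet> x)" for x
        by (subst sb) (auto simp: inner_commute[of b x] divide_inverse mult.commute)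
      then show "trig_poly (\<lambda>x. s x \<bullet> b)" by (simp only: trig_poly.sin)
    qed
    show "\<bar>f x - q (s x)\<bar> \<le> e" if x: "norm x \<le> L" for x
    proof -
      have "A (s x) = (\<Sum>b\<in>Basis. (x \<bullet> b) *\<^sub>R b)"
        unfolding A_def
      proof (intro sum.cong refl)
        fix b :: 'b assume b: "b \<in> Basis"
        have "\<bar>(x \<bullet> b) / L\<bar> \<le> 1" using Basis_le_norm[OF b, of x] x L by simp
        then have "arcsin (sin ((x \<bullet> b) / L)) = (x \<bullet> b) / L"
          using pi_gt3 unfolding abs_le_iff by (intro arcsin_sin) linarith+
        then show "(L * arcsin (s x \<bullet> b)) *\<^sub>R b = (x \<bullet> b) *\<^sub>R b"
          using b L by (simp add: sb)
      qed
      then have "A (s x) = x" by (simp add: euclidean_representation)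
      with q(2)[OF sK, of x] show ?thesis by simp
    qed
    show "\<bar>q (s x)\<bar> \<le> B + e" for x
      using q(2)[OF sK, of x] f(2)[of "A (s x)"] by linarith
  qed
qed

text \<open>
  Approximate \<open>f\<close> by a trigonometric polynomial on a large ball.  Outside of the ball both functions
  are bounded, and the second moments make this region uniformly negligible.
\<close>

lemma levy_continuity_bounded_second_moment:
  fixes Z :: "nat \<Rightarrow> 'a \<Rightarrow> 'b::euclidean_space" and \<nu> :: "'b measure"
  assumes M: "prob_space M" and \<nu>: "prob_space \<nu>" "sets \<nu> = sets borel"
    and Z: "\<And>n. Z n \<in> borel_measurable M"
    and int: "\<And>n. integrable M (\<lambda>\<omega>. (norm (Z n \<omega>))\<^sup>2)" "integrable \<nu> (\<lambda>x. (norm x)\<^sup>2)"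
    and bd: "\<forall>\<^sub>F n in sequentially. (\<integral>\<omega>. (norm (Z n \<omega>))\<^sup>2 \<partial>M) \<le> V"
    and char: "\<And>c. (\<lambda>n. \<integral>\<omega>. iexp (c \<bullet> Z n \<omega>) \<partial>M) \<longlonglongrightarrow> (\<integral>x. iexp (c \<bullet> x) \<partial>\<nu>)"
  shows "converges_in_distribution M Z \<nu>"
  unfolding converges_in_distribution_def
proof (intro conjI allI impI Z)
  fix f :: "'b \<Rightarrow> real" assume f: "continuous_on UNIV f" "bounded (range f)"
  interpret M: prob_space M by fact
  interpret N: prob_space \<nu> by fact
  note [measurable] = Z
  note [measurable_cong] = \<nu>(2)
  have [measurable]: "f \<in> borel_measurable borel"
    using f(1) by (rule borel_measurable_continuous_onI)
  obtain B0 where "\<And>x. \<bar>f x\<bar> \<le> B0" using f(2) by (auto simp: bounded_iff)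
  then obtain B where B: "\<And>x. \<bar>f x\<bar> \<le> B" "0 < B"
    by (metis abs_ge_zero dual_order.trans le_max_iff_disj less_max_iff_disj max.cobounded1 zero_less_one)
  have trig: "(\<lambda>n. \<integral>\<omega>. p (Z n \<omega>) \<partial>M) \<longlonglongrightarrow> (\<integral>x. p x \<partial>\<nu>) \<and>
     (\<forall>n. integrable M (\<lambda>\<omega>. p (Z n \<omega>))) \<and> integrable \<nu> p" if "trig_poly p" for p
    using that
  proof (induction rule: trig_poly.induct)
    case (cos r c)
    have i: "integrable M (\<lambda>\<omega>. iexp (c \<bullet> Z n \<omega>))" "integrable \<nu> (\<lambda>x. iexp (c \<bullet> x))" for n
      by (auto intro!: M.integrable_iexp N.integrable_iexp)
    from tendsto_Re[OF char[of c]]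
    have "(\<lambda>n. \<integral>\<omega>. cos (c \<bullet> Z n \<omega>) \<partial>M) \<longlonglongrightarrow> (\<integral>x. cos (c \<bullet> x) \<partial>\<nu>)"
      using i by (simp flip: integral_Re add: cis_conv_exp[symmetric] )
    moreover have "integrable M (\<lambda>\<omega>. cos (c \<bullet> Z n \<omega>))" "integrable \<nu> (\<lambda>x. cos (c \<bullet> x))" for n
      by (auto intro!: M.integrable_const_bound[of _ 1] N.integrable_const_bound[of _ 1])
    ultimately show ?case by (auto intro!: tendsto_mult_left)
  next
    case (sin r c)
    have i: "integrable M (\<lambda>\<omega>. iexp (c \<bullet> Z n \<omega>))" "integrable \<nu> (\<lambda>x. iexp (c \<bullet> x))" for n
      by (auto intro!: M.integrable_iexp N.integrable_iexp)
    from tendsto_Im[OF char[of c]]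
    have "(\<lambda>n. \<integral>\<omega>. sin (c \<bullet> Z n \<omega>) \<partial>M) \<longlonglongrightarrow> (\<integral>x. sin (c \<bullet> x) \<partial>\<nu>)"
      using i by (simp flip: integral_Im add: cis_conv_exp[symmetric])
    moreover have "integrable M (\<lambda>\<omega>. sin (c \<bullet> Z n \<omega>))" "integrable \<nu> (\<lambda>x. sin (c \<bullet> x))" for n
      by (auto intro!: M.integrable_const_bound[of _ 1] N.integrable_const_bound[of _ 1])
    ultimately show ?case by (auto intro!: tendsto_mult_left)
  next
    case (add f g)
    then show ?case by (auto intro!: tendsto_add)
  qed
  have "(\<lambda>n. \<integral>\<omega>. f (Z n \<omega>) \<partial>M) \<longlonglongrightarrow> (\<integral>x. f x \<partial>\<nu>)"
  proof (rule LIMSEQ_I)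
    fix r :: real assume r: "0 < r"
    define W where "W = max V (\<integral>x. (norm x)\<^sup>2 \<partial>\<nu>)"
    define e where "e = min 1 (r / 8)"
    have e: "0 < e" "e \<le> 1" "e \<le> r / 8" using r by (auto simp: e_def)
    define C where "C = 2 * B + 1"
    have C: "0 < C" using B(2) by (simp add: C_def)
    have W: "0 \<le> W" by (simp add: W_def le_max_iff_disj)
    \<comment> \<open>A radius for which Chebyshev's inequality makes the tails contribute at most \<open>e\<close>.\<close>
    obtain L where L: "0 < L" "C * W / L\<^sup>2 \<le> e"
    proof
      show "0 < sqrt (C * W / e + 1)" using C W e by (simp add: add_nonneg_pos)
      have "0 < C * W / e + 1" "C * W \<le> e * (C * W / e + 1)"
        using C W e by (auto simp: add_nonneg_pos distrib_left)
      then have "C * W / (C * W / e + 1) \<le> e"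
        by (simp only: pos_divide_le_eq)
      then show "C * W / (sqrt (C * W / e + 1))\<^sup>2 \<le> e" using C W e by simp
    qed
    obtain p where p: "trig_poly p" "\<And>x. norm x \<le> L \<Longrightarrow> \<bar>f x - p x\<bar> \<le> e" "\<And>x. \<bar>p x\<bar> \<le> B + e"
      using trig_poly_approximation[OF f(1) B(1) L(1) e(1)] by blast
    have pt: "\<bar>f x - p x\<bar> \<le> e + C / L\<^sup>2 * (norm x)\<^sup>2" for x
    proof (cases "norm x \<le> L")
      case True
      have "0 \<le> C / L\<^sup>2 * (norm x)\<^sup>2" using C by simp
      with p(2)[OF True] show ?thesis by linarith
    next
      case False
      then have "1 \<le> (norm x)\<^sup>2 / L\<^sup>2" using L(1) by (simp add: power_mono)
      then have "C * 1 \<le> C * ((norm x)\<^sup>2 / L\<^sup>2)" using C by (intro mult_left_mono) auto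
      moreover have "\<bar>f x - p x\<bar> \<le> C + e" using B(1)[of x] p(3)[of x] unfolding C_def using e by linarith
      ultimately show ?thesis by simp
    qed
    have err: "\<bar>(\<integral>x. f (g x) \<partial>N) - (\<integral>x. p (g x) \<partial>N)\<bar> \<le> 2 * e"
      if "prob_space N" "g \<in> borel_measurable N" "integrable N (\<lambda>x. p (g x))"
        "integrable N (\<lambda>x. (norm (g x))\<^sup>2)" "(\<integral>x. (norm (g x))\<^sup>2 \<partial>N) \<le> W" for N :: "'c measure" and g
    proof -
      interpret prob_space N by fact
      note [measurable] = that(2)
      have fi: "integrable N (\<lambda>x. f (g x))" by (intro integrable_const_bound[of _ B]) (use B in auto)
      have "\<bar>(\<integral>x. f (g x) \<partial>N) - (\<integral>x. p (g x) \<partial>N)\<bar> = \<bar>\<integral>x. f (g x) - p (g x) \<partial>N\<bar>"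
        using fi that(3) by simp
      also have "\<dots> \<le> (\<integral>x. \<bar>f (g x) - p (g x)\<bar> \<partial>N)" by (rule integral_abs_bound)
      also have "\<dots> \<le> (\<integral>x. e + C / L\<^sup>2 * (norm (g x))\<^sup>2 \<partial>N)"
        by (intro integral_mono integrable_abs Bochner_Integration.integrable_diff fi that(3)
           Bochner_Integration.integrable_add integrable_const integrable_mult_right that(4) pt)
      also have "\<dots> = e + C / L\<^sup>2 * (\<integral>x. (norm (g x))\<^sup>2 \<partial>N)"
        using that(4) by (simp add: prob_space)
      also have "\<dots> \<le> e + C / L\<^sup>2 * W"
        using that(5) C by (intro add_left_mono mult_left_mono) auto
      also have "\<dots> \<le> 2 * e" using L(2) by simp
      finally show ?thesis .
    qed
    have e1: "\<bar>(\<integral>x. f x \<partial>\<nu>) - (\<integral>x. p x \<partial>\<nu>)\<bar> \<le> 2 * e"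
      by (rule err[OF \<nu>(1), of "\<lambda>x. x"]) (use trig[OF p(1)] int in \<open>auto simp: W_def\<close>)
    have e2: "\<forall>\<^sub>F n in sequentially. \<bar>(\<integral>\<omega>. f (Z n \<omega>) \<partial>M) - (\<integral>\<omega>. p (Z n \<omega>) \<partial>M)\<bar> \<le> 2 * e"
      using bd
    proof eventually_elim
      case (elim n)
      show ?case by (rule err[OF M, of "Z n"]) (use elim trig[OF p(1)] int in \<open>auto simp: W_def\<close>)
    qed
    have "\<forall>\<^sub>F n in sequentially. \<bar>(\<integral>\<omega>. p (Z n \<omega>) \<partial>M) - (\<integral>x. p x \<partial>\<nu>)\<bar> < e"
      using tendstoD[OF trig[OF p(1), THEN conjunct1] e(1)] by (simp add: dist_real_def)
    with e2 have "\<forall>\<^sub>F n in sequentially. norm ((\<integral>\<omega>. f (Z n \<omega>) \<partial>M) - (\<integral>x. f x \<partial>\<nu>)) < r"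
    proof eventually_elim
      case (elim n)
      then show ?case using e1 e(1,3) unfolding real_norm_def by linarith
    qed
    then show "\<exists>no. \<forall>n\<ge>no. norm ((\<integral>\<omega>. f (Z n \<omega>) \<partial>M) - (\<integral>x. f x \<partial>\<nu>)) < r"
      by (simp add: eventually_sequentially)
  qed
  then show "(\<lambda>n. \<integral>x. f x \<partial>distr M borel (Z n)) \<longlonglongrightarrow> (\<integral>x. f x \<partial>\<nu>)"
    by (simp add: integral_distr)
qed

section \<open>Bivariate normal laws\<close>

text \<open>
  A converse to the formula for the characteristic function, with \<open>s = 0\<close> for almost surely
  vanishing variables.
\<close>

lemma gaussian_of_char:
  assumes M: "prob_space M" and Y[measurable]: "Y \<in> borel_measurable M" and s: "0 \<le> s"
    and ch: "\<And>u. (\<integral>\<omega>. iexp (u * Y \<omega>) \<partial>M) = of_real (exp (- (s * u)\<^sup>2 / 2))"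
  shows "gaussian_rv M Y" "(\<integral>\<omega>. Y \<omega> \<partial>M) = 0" "(\<integral>\<omega>. (Y \<omega>)\<^sup>2 \<partial>M) = s\<^sup>2"
proof -
  interpret prob_space M by fact
  interpret N: prob_space std_normal_distribution by (rule prob_space_normal_density) simp
  have law: "distr M borel Y = distr std_normal_distribution borel (\<lambda>x. s * x)"
  proof (rule Levy_uniqueness)
    show "real_distribution (distr M borel Y)" "real_distribution (distr std_normal_distribution borel (\<lambda>x. s * x))"
      by (auto intro!: real_distribution_distr N.real_distribution_distr)
    have "char (distr std_normal_distribution borel (\<lambda>x. s * x)) u = char std_normal_distribution (s * u)" for u
      by (simp add: char_def integral_distr mult_ac)
    moreover have "char (distr M borel Y) u = of_real (exp (- (s * u)\<^sup>2 / 2))" for u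
      using ch[of u] by (simp add: char_def integral_distr del: of_real_mult)
    ultimately show "char (distr M borel Y) = char (distr std_normal_distribution borel (\<lambda>x. s * x))"
      by (simp add: fun_eq_iff char_std_normal_distribution)
  qed
  show "gaussian_rv M Y"
  proof (cases "s = 0")
    case True
    have "AE x in distr M borel Y. x = 0"
      unfolding law True by (subst AE_distr_iff) auto
    then have "AE \<omega> in M. Y \<omega> = 0" by (subst (asm) AE_distr_iff) auto
    then show ?thesis by (auto simp: gaussian_rv_def)
  next
    case False
    with s have "0 < s" by simp
    then have "distr M borel Y = density lborel (normal_density 0 s)"
      unfolding law by (rule std_normal_scaled)
    moreover have "distr M lborel Y = distr M borel Y" by (rule distr_cong) auto
    ultimately have "distributed M lborel Y (normal_density 0 s)"
      by (simp add: distributed_def)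
    with \<open>0 < s\<close> show ?thesis by (auto simp: gaussian_rv_def)
  qed
  have "(\<integral>\<omega>. f (Y \<omega>) \<partial>M) = (\<integral>x. f (s * x) \<partial>std_normal_distribution)"
    if [measurable]: "f \<in> borel_measurable borel" for f :: "real \<Rightarrow> real"
    using arg_cong[OF law, of "\<lambda>\<mu>. integral\<^sup>L \<mu> f"] by (simp add: integral_distr)
  from this[of "\<lambda>x. x"] this[of "\<lambda>x. x\<^sup>2"]
  show "(\<integral>\<omega>. Y \<omega> \<partial>M) = 0" "(\<integral>\<omega>. (Y \<omega>)\<^sup>2 \<partial>M) = s\<^sup>2"
    using integral_std_normal_distribution_moment_odd[of 1] std_normal_distribution_even_moments[of 1]
    by (auto simp: power_mult_distrib has_bochner_integral_iff)
qed

text \<open>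
  The law is the image of two independent standard normal variables under the Cholesky factor of
  the covariance matrix.  If \<open>A = 0\<close> then \<open>B = 0\<close> by semidefiniteness, and since division by 0 gives
  0, the formulas for the factor remain correct.  All moments are obtained from the
  characteristic function, using that every linear functional of the vector is Gaussian.
\<close>

lemma bivariate_normal_exists:
  fixes A B D :: real
  assumes psd: "\<And>a b. 0 \<le> A * a\<^sup>2 + 2 * B * (a * b) + D * b\<^sup>2"
  obtains \<nu> :: "(real ^ 2) measure" where
    "is_multivariate_normal 0 (vector [vector [A, B], vector [B, D]]) \<nu>"
    "\<And>c. (\<integral>x. iexp (c \<bullet> x) \<partial>\<nu>) = of_real (exp (- (A * (c $ 1)\<^sup>2 + 2 * B * (c $ 1 * c $ 2) + D * (c $ 2)\<^sup>2) / 2))"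
    "integrable \<nu> (\<lambda>x. (norm x)\<^sup>2)"
proof -
  let ?N = std_normal_distribution
  interpret N: prob_space ?N by (rule prob_space_normal_density) simp
  interpret NN: pair_prob_space ?N ?N ..
  have A: "0 \<le> A" and D: "0 \<le> D" using psd[of 1 0] psd[of 0 1] by simp_all
  \<comment> \<open>With \<open>A = 0\<close> the form is linear in \<open>a\<close>, so it takes negative values unless \<open>B = 0\<close>.\<close>
  have B0: "B = 0" if "A = 0"
    using psd[of "- (D + 1) / (2 * B)" 1] that by (cases "B = 0") auto
  define \<alpha> where "\<alpha> = sqrt A"
  define \<beta> where "\<beta> = B / sqrt A"
  define \<gamma> where "\<gamma> = sqrt (D - B\<^sup>2 / A)"
  have \<gamma>0: "0 \<le> D - B\<^sup>2 / A"
  proof (cases "A = 0")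
    case False
    have "0 \<le> A * (- B / A)\<^sup>2 + 2 * B * (- B / A * 1) + D * 1\<^sup>2" by (rule psd)
    with False show ?thesis by (simp add: power2_eq_square)
  qed (use D in simp)
  have \<alpha>\<alpha>: "\<alpha> * \<alpha> = A" using A by (simp add: \<alpha>_def)
  have \<alpha>\<beta>: "\<alpha> * \<beta> = B" using A B0 by (cases "A = 0") (simp_all add: \<alpha>_def \<beta>_def)
  have \<beta>\<gamma>: "\<beta> * \<beta> + \<gamma> * \<gamma> = D" using A \<gamma>0 by (simp add: \<beta>_def \<gamma>_def power2_eq_square)
  define G :: "real \<times> real \<Rightarrow> real ^ 2" where
    "G p = vector [\<alpha> * fst p, \<beta> * fst p + \<gamma> * snd p]" for p
  define \<nu> where "\<nu> = distr (?N \<Otimes>\<^sub>M ?N) borel G"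
  have inner: "c \<bullet> G p = (c $ 1 * \<alpha> + c $ 2 * \<beta>) * fst p + c $ 2 * \<gamma> * snd p" for c p
    by (simp add: G_def inner_vec_def sum_2 vector_2 algebra_simps)
  have G_m[measurable]: "G \<in> borel_measurable (?N \<Otimes>\<^sub>M ?N)"
    unfolding borel_measurable_euclidean_space[of G]
    by (auto simp: inner inner_commute[of "G _"])
  have P: "prob_space \<nu>" unfolding \<nu>_def by (rule NN.P.prob_space_distr) measurable
  interpret P: prob_space \<nu> by fact
  have sets[measurable_cong]: "sets \<nu> = sets borel" by (simp add: \<nu>_def)
  define quad where "quad c = A * (c $ 1)\<^sup>2 + 2 * B * (c $ 1 * c $ 2) + D * (c $ 2)\<^sup>2" for c :: "real ^ 2"
  have quad0: "0 \<le> quad c" for c unfolding quad_def by (rule psd)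
  have ch: "(\<integral>x. iexp (c \<bullet> x) \<partial>\<nu>) = of_real (exp (- quad c / 2))" for c
  proof -
    define p where "p = c $ 1 * \<alpha> + c $ 2 * \<beta>"
    define q where "q = c $ 2 * \<gamma>"
    have pq: "p\<^sup>2 + q\<^sup>2 = quad c"
      unfolding quad_def \<alpha>\<alpha>[symmetric] \<alpha>\<beta>[symmetric] \<beta>\<gamma>[symmetric]
      by (simp add: p_def q_def power2_eq_square algebra_simps)
    have int: "integrable (?N \<Otimes>\<^sub>M ?N) (\<lambda>z. iexp (p * fst z + q * snd z))"
      by (intro NN.P.integrable_const_bound[of _ 1]) (auto simp del: of_real_add of_real_mult)
    have "(\<integral>x. iexp (c \<bullet> x) \<partial>\<nu>) = (\<integral>z. iexp (p * fst z + q * snd z) \<partial>(?N \<Otimes>\<^sub>M ?N))"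
      unfolding \<nu>_def by (subst integral_distr) (auto simp: inner p_def q_def)
    also have "\<dots> = (\<integral>x. \<integral>y. iexp (p * x + q * y) \<partial>?N \<partial>?N)"
      using NN.integral_fst'[OF int] by simp
    also have "\<dots> = char ?N p * char ?N q"
      by (simp add: char_def distrib_left exp_add)
    also have "\<dots> = of_real (exp (- (p\<^sup>2 + q\<^sup>2) / 2))"
      by (simp add: char_std_normal_distribution add_divide_distrib flip: of_real_mult exp_add)
    finally show ?thesis by (simp only: pq)
  qed
  have g: "gaussian_rv \<nu> (\<lambda>x. c \<bullet> x)" "(\<integral>x. c \<bullet> x \<partial>\<nu>) = 0" "(\<integral>x. (c \<bullet> x)\<^sup>2 \<partial>\<nu>) = quad c" for c
  proof -
    have e: "(\<integral>x. iexp (u * (c \<bullet> x)) \<partial>\<nu>) = of_real (exp (- (sqrt (quad c) * u)\<^sup>2 / 2))" for u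
    proof -
      have "quad (u *\<^sub>R c) = (sqrt (quad c) * u)\<^sup>2"
        using quad0[of c] by (simp add: power_mult_distrib) (simp add: quad_def power2_eq_square algebra_simps)
      then show ?thesis using ch[of "u *\<^sub>R c"] by simp
    qed
    from gaussian_of_char[OF P _ _ e] quad0[of c]
    show "gaussian_rv \<nu> (\<lambda>x. c \<bullet> x)" "(\<integral>x. c \<bullet> x \<partial>\<nu>) = 0" "(\<integral>x. (c \<bullet> x)\<^sup>2 \<partial>\<nu>) = quad c" by auto
  qed
  have int2: "integrable \<nu> (\<lambda>x. (c \<bullet> x) ^ k)" for c k
    using centered_gaussian_power_integrable[OF P g(1,2)] .
  have comp: "x $ 1 = vector [1, 0] \<bullet> x" "x $ 2 = vector [0, 1] \<bullet> x" for x :: "real ^ 2"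
    by (simp_all add: inner_vec_def sum_2 vector_2)
  have m: "(\<integral>x. x $ i \<partial>\<nu>) = 0" for i
    using g(2)[of "vector [1, 0]"] g(2)[of "vector [0, 1]"] exhaust_2[of i] by (auto simp: comp[symmetric])
  have sq: "integrable \<nu> (\<lambda>x. (x $ i)\<^sup>2)" for i
    using int2[of "vector [1, 0]" 2] int2[of "vector [0, 1]" 2] exhaust_2[of i] by (auto simp: comp[symmetric])
  have e11: "(\<integral>x. x $ 1 * x $ 1 \<partial>\<nu>) = A" and e22: "(\<integral>x. x $ 2 * x $ 2 \<partial>\<nu>) = D"
    using g(3)[of "vector [1, 0]"] g(3)[of "vector [0, 1]"]
    by (auto simp: comp[symmetric] quad_def vector_2 power2_eq_square)
  have e12: "(\<integral>x. x $ 1 * x $ 2 \<partial>\<nu>) = B"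
  proof -
    have "x $ 1 * x $ 2 = ((vector [1, 1] \<bullet> x)\<^sup>2 - (x $ 1)\<^sup>2 - (x $ 2)\<^sup>2) / 2" for x :: "real ^ 2"
      by (simp add: inner_vec_def sum_2 vector_2 power2_eq_square algebra_simps)
    then have "(\<integral>x. x $ 1 * x $ 2 \<partial>\<nu>) =
      (\<integral>x. ((vector [1, 1] \<bullet> x)\<^sup>2 - (x $ 1)\<^sup>2 - (x $ 2)\<^sup>2) / 2 \<partial>\<nu>)"
      by (simp only:)
    also have "\<dots> = (quad (vector [1, 1]) - A - D) / 2"
      using sq int2[of "vector [1, 1]" 2] g(3)[of "vector [1, 1]"] e11[folded power2_eq_square] e22[folded power2_eq_square]
      by simp
    finally have "(\<integral>x. x $ 1 * x $ 2 \<partial>\<nu>) = (quad (vector [1, 1]) - A - D) / 2" .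
    then show ?thesis by (simp add: quad_def vector_2)
  qed
  show ?thesis
  proof
    show "is_multivariate_normal 0 (vector [vector [A, B], vector [B, D]]) \<nu>"
      unfolding is_multivariate_normal_def covariance_def m
      using P sets g(1) e11 e12 e22 by (auto simp: forall_2 vector_2 mult.commute[of "_ $ 2" "_ $ 1"])
    show "(\<integral>x. iexp (c \<bullet> x) \<partial>\<nu>) = of_real (exp (- (A * (c $ 1)\<^sup>2 + 2 * B * (c $ 1 * c $ 2) + D * (c $ 2)\<^sup>2) / 2))" for c
      using ch[of c] by (simp only: quad_def)
    have "(norm x)\<^sup>2 = (x $ 1)\<^sup>2 + (x $ 2)\<^sup>2" for x :: "real ^ 2"
      unfolding power2_norm_eq_inner by (simp add: inner_vec_def sum_2 power2_eq_square)
    then show "integrable \<nu> (\<lambda>x. (norm x)\<^sup>2)" using sq by simp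
  qed
qed

section \<open>Second differences of a Gaussian process\<close>

definition process_span :: "'t set \<Rightarrow> ('t \<Rightarrow> 'a \<Rightarrow> real) \<Rightarrow> ('a \<Rightarrow> real) set" where
  "process_span I X = {Z. \<exists>F c. finite F \<and> F \<subseteq> I \<and> Z = (\<lambda>\<omega>. \<Sum>t\<in>F. c t * X t \<omega>)}"

lemma process_span_base: "t \<in> I \<Longrightarrow> X t \<in> process_span I X"
  unfolding process_span_def by (intro CollectI exI[of _ "{t}"] exI[of _ "\<lambda>_. 1"]) auto

lemma process_span_zero: "(\<lambda>_. 0) \<in> process_span I X"
  unfolding process_span_def by (intro CollectI exI[of _ "{}"]) auto

lemma process_span_scale: "Z \<in> process_span I X \<Longrightarrow> (\<lambda>\<omega>. a * Z \<omega>) \<in> process_span I X"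
proof -
  assume "Z \<in> process_span I X"
  then obtain F c where F: "finite F" "F \<subseteq> I" "Z = (\<lambda>\<omega>. \<Sum>t\<in>F. c t * X t \<omega>)"
    by (auto simp: process_span_def)
  then have "(\<lambda>\<omega>. a * Z \<omega>) = (\<lambda>\<omega>. \<Sum>t\<in>F. (a * c t) * X t \<omega>)"
    by (simp add: sum_distrib_left mult_ac)
  with F(1,2) show ?thesis
    unfolding process_span_def by (intro CollectI exI[of _ F] exI[of _ "\<lambda>t. a * c t"]) simp
qed

lemma process_span_add:
  assumes "Z \<in> process_span I X" "Z' \<in> process_span I X"
  shows "(\<lambda>\<omega>. Z \<omega> + Z' \<omega>) \<in> process_span I X"
proof -
  obtain F c where F: "finite F" "F \<subseteq> I" "Z = (\<lambda>\<omega>. \<Sum>t\<in>F. c t * X t \<omega>)"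
    using assms(1) by (auto simp: process_span_def)
  obtain F' c' where F': "finite F'" "F' \<subseteq> I" "Z' = (\<lambda>\<omega>. \<Sum>t\<in>F'. c' t * X t \<omega>)"
    using assms(2) by (auto simp: process_span_def)
  define d where "d t = (if t \<in> F then c t else 0) + (if t \<in> F' then c' t else 0)" for t
  have "(\<Sum>t\<in>F. c t * X t \<omega>) = (\<Sum>t\<in>F \<union> F'. (if t \<in> F then c t else 0) * X t \<omega>)"
    "(\<Sum>t\<in>F'. c' t * X t \<omega>) = (\<Sum>t\<in>F \<union> F'. (if t \<in> F' then c' t else 0) * X t \<omega>)" for \<omega>
    using F(1) F'(1) by (auto intro!: sum.mono_neutral_cong_left)
  then have "(\<lambda>\<omega>. Z \<omega> + Z' \<omega>) = (\<lambda>\<omega>. \<Sum>t\<in>F \<union> F'. d t * X t \<omega>)"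
    using F(3) F'(3) by (simp add: d_def distrib_right sum.distrib)
  moreover have "finite (F \<union> F')" "F \<union> F' \<subseteq> I" using F F' by auto
  ultimately show ?thesis
    unfolding process_span_def by (intro CollectI exI[of _ "F \<union> F'"] exI[of _ d]) simp
qed

lemma process_span_sum:
  assumes "finite A" "\<And>l. l \<in> A \<Longrightarrow> Y l \<in> process_span I X"
  shows "(\<lambda>\<omega>. \<Sum>l\<in>A. c l * Y l \<omega>) \<in> process_span I X"
  using assms
proof (induction rule: finite_induct)
  case empty
  then show ?case by (simp add: process_span_zero)
next
  case (insert l A)
  then have "(\<lambda>\<omega>. c l * Y l \<omega> + (\<Sum>l\<in>A. c l * Y l \<omega>)) \<in> process_span I X"
    by (intro process_span_add process_span_scale) auto
  with insert.hyps show ?case by simp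
qed

lemma process_span_gaussian: "gaussian_process M I X \<Longrightarrow> Z \<in> process_span I X \<Longrightarrow> gaussian_rv M Z"
  unfolding gaussian_process_def process_span_def by auto

lemma process_span_mean:
  assumes "prob_space M" "gaussian_process M I X" "\<And>t. t \<in> I \<Longrightarrow> (\<integral>\<omega>. X t \<omega> \<partial>M) = 0" "Z \<in> process_span I X"
  shows "(\<integral>\<omega>. Z \<omega> \<partial>M) = 0"
proof -
  obtain F c where F: "finite F" "F \<subseteq> I" "Z = (\<lambda>\<omega>. \<Sum>t\<in>F. c t * X t \<omega>)"
    using assms(4) by (auto simp: process_span_def)
  have "integrable M (X t)" if "t \<in> F" for t
    using centered_gaussian_power_integrable[OF assms(1) process_span_gaussian[OF assms(2) process_span_base], of t 1]
      that F(2) assms(3) by auto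
  moreover have "(\<integral>\<omega>. X t \<omega> \<partial>M) = 0" if "t \<in> F" for t
    using that F(2) assms(3) by auto
  ultimately show ?thesis
    unfolding F(3) by (subst Bochner_Integration.integral_sum) simp_all
qed

locale gaussian_second_differences = prob_space M for M :: "'a measure" +
  fixes X :: "real \<Rightarrow> 'a \<Rightarrow> real" and T :: real
  assumes T_pos: "0 < T"
    and process: "gaussian_process M {0..T} X"
    and mean_zero: "\<And>t. t \<in> {0..T} \<Longrightarrow> expectation (X t) = 0"
    and nondegenerate: "\<And>N k. 2 \<le> N \<Longrightarrow> k \<in> {1..N-1} \<Longrightarrow> 0 < expectation (\<lambda>\<omega>. (second_diff X T N k \<omega>)\<^sup>2)"
begin

text \<open>
  A pair \<open>(i, k)\<close> stands for the second difference with index \<open>k\<close> at level \<open>i * n\<close>; both levels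
  are put into one Gaussian vector since they have to be treated jointly.
\<close>

definition grid :: "nat \<Rightarrow> (nat \<times> nat) set" where
  "grid n = Sigma {1, 2} (\<lambda>i. {1..i * n - 1})"

definition increment :: "nat \<Rightarrow> nat \<times> nat \<Rightarrow> 'a \<Rightarrow> real" where
  "increment n = (\<lambda>(i, k). normalized_second_diff M X T (i * n) k)"

lemma second_diff_in_span:
  assumes k: "k \<in> {1..N-1}"
  shows "second_diff X T N k \<in> process_span {0..T} X"
proof -
  have *: "real m / real N * T \<in> {0..T}" if "m \<le> N" for m
  proof -
    have "real m / real N \<le> 1" using that by (cases "N = 0") (simp_all add: divide_le_eq_1)
    from mult_right_mono[OF this, of T] show ?thesis using T_pos by simp
  qed
  have "(real k + 1) / real N * T \<in> {0..T}" "real k / real N * T \<in> {0..T}" "(real k - 1) / real N * T \<in> {0..T}"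
    using *[of "k + 1"] *[of k] *[of "k - 1"] k by (simp_all only: of_nat_add of_nat_1 of_nat_diff atLeastAtMost_iff) auto
  then have "(\<lambda>\<omega>. (X ((real k + 1) / real N * T) \<omega> + (-2) * X (real k / real N * T) \<omega>) + X ((real k - 1) / real N * T) \<omega>)
    \<in> process_span {0..T} X"
    by (intro process_span_add process_span_scale process_span_base)
  then show ?thesis by (simp add: second_diff_def[abs_def])
qed

lemma normalized_second_diff_in_span:
  assumes k: "k \<in> {1..N-1}"
  shows "normalized_second_diff M X T N k \<in> process_span {0..T} X"
  using process_span_scale[OF second_diff_in_span[OF k], of "1 / sqrt (expectation (\<lambda>\<omega>. (second_diff X T N k \<omega>)\<^sup>2))"]
  by (simp add: normalized_second_diff_def[abs_def])

lemma normalized_second_diff_variance: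
  assumes k: "k \<in> {1..N-1}"
  shows "expectation (\<lambda>\<omega>. (normalized_second_diff M X T N k \<omega>)\<^sup>2) = 1"
proof -
  have "2 \<le> N" using k by auto
  from nondegenerate[OF this k] show ?thesis
    by (simp add: normalized_second_diff_def power_divide)
qed

sublocale vec: standard_gaussian_vector M "grid n" "increment n" for n
proof
  show fin: "finite (grid n)" by (simp add: grid_def)
  have span: "increment n l \<in> process_span {0..T} X" if "l \<in> grid n" for l
    using that normalized_second_diff_in_span by (auto simp: grid_def increment_def)
  show "gaussian_rv M (\<lambda>\<omega>. \<Sum>l\<in>grid n. c l * increment n l \<omega>)" for c
    by (intro process_span_gaussian[OF process] process_span_sum[OF fin span])
  show "expectation (increment n l) = 0" if "l \<in> grid n" for l
    by (rule process_span_mean[OF prob_space_axioms process mean_zero span[OF that]])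
  show "expectation (\<lambda>\<omega>. (increment n l \<omega>)\<^sup>2) = 1" if "l \<in> grid n" for l
    using that normalized_second_diff_variance by (auto simp: grid_def increment_def)
qed

definition fluctuation :: "nat \<Rightarrow> nat \<Rightarrow> 'a \<Rightarrow> real" where
  "fluctuation n i \<omega> = sqrt (real n) *
     ((quadratic_variation M X T (i * n) \<omega> - expectation (quadratic_variation M X T (i * n))) / real (i * n))"

text \<open>
  The weights for which \<open>Q\<close> is the linear combination of the two fluctuations with
  coefficients \<open>c 1\<close> and \<open>c 2\<close>.
\<close>

definition weight :: "nat \<Rightarrow> (nat \<Rightarrow> real) \<Rightarrow> nat \<times> nat \<Rightarrow> real" where
  "weight n c = (\<lambda>(i, k). c i * sqrt (real n) / real (i * n))"

lemma quadratic_variation_mean: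
  "expectation (quadratic_variation M X T N) = real (N - 1)"
proof -
  have i: "integrable M (\<lambda>\<omega>. (normalized_second_diff M X T N k \<omega>)\<^sup>2)" if "k \<in> {1..N-1}" for k
    using centered_gaussian_power_integrable[OF prob_space_axioms process_span_gaussian[OF process] process_span_mean[OF prob_space_axioms process mean_zero]]
      normalized_second_diff_in_span[OF that] by blast
  show ?thesis
    unfolding quadratic_variation_def[abs_def] using i normalized_second_diff_variance
    by (subst Bochner_Integration.integral_sum) auto
qed

lemma Q_weight:
  "vec.Q n (weight n c) \<omega> = c 1 * fluctuation n 1 \<omega> + c 2 * fluctuation n 2 \<omega>"
proof -
  have "vec.Q n (weight n c) \<omega> = (\<Sum>l\<in>grid n. weight n c l * ((increment n l \<omega>)\<^sup>2 - 1))"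
    by (rule vec.Q_def)
  also have "\<dots> = (\<Sum>i\<in>{1, 2}. \<Sum>k\<in>{1..i * n - 1}.
     c i * sqrt (real n) / real (i * n) * ((normalized_second_diff M X T (i * n) k \<omega>)\<^sup>2 - 1))"
    unfolding grid_def by (subst sum.Sigma) (auto simp: weight_def increment_def intro!: sum.cong)
  also have "\<dots> = (\<Sum>i\<in>{1, 2}. c i * fluctuation n i \<omega>)"
    unfolding fluctuation_def quadratic_variation_mean sum_distrib_left[symmetric]
    by (intro sum.cong refl) (simp add: quadratic_variation_def sum_subtractf)
  finally show ?thesis by simp
qed

lemma fluctuation_measurable[measurable]: "fluctuation n 1 \<in> borel_measurable M" "fluctuation n 2 \<in> borel_measurable M"
proof -
  have "fluctuation n 1 = vec.Q n (weight n (\<lambda>i. if i = 1 then 1 else 0))"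
    "fluctuation n 2 = vec.Q n (weight n (\<lambda>i. if i = 2 then 1 else 0))"
    by (simp_all add: fun_eq_iff Q_weight)
  then show "fluctuation n 1 \<in> borel_measurable M" "fluctuation n 2 \<in> borel_measurable M"
    by simp_all
qed

lemma fluctuation_integrable:
  "integrable M (\<lambda>\<omega>. (a * fluctuation n 1 \<omega> + b * fluctuation n 2 \<omega>)\<^sup>2)"
  using vec.integrable_Q_sq[of n "weight n (\<lambda>i. if i = 1 then a else b)"] by (simp add: Q_weight)

lemma fluctuation_products_integrable:
  "integrable M (\<lambda>\<omega>. fluctuation n 1 \<omega> * fluctuation n 1 \<omega>)"
  "integrable M (\<lambda>\<omega>. fluctuation n 2 \<omega> * fluctuation n 2 \<omega>)"
  "integrable M (\<lambda>\<omega>. fluctuation n 1 \<omega> * fluctuation n 2 \<omega>)"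
proof -
  show 1: "integrable M (\<lambda>\<omega>. fluctuation n 1 \<omega> * fluctuation n 1 \<omega>)"
    and 2: "integrable M (\<lambda>\<omega>. fluctuation n 2 \<omega> * fluctuation n 2 \<omega>)"
    using fluctuation_integrable[of 1 n 0] fluctuation_integrable[of 0 n 1] by (simp_all add: power2_eq_square)
  have polarization: "fluctuation n 1 \<omega> * fluctuation n 2 \<omega> =
    ((1 * fluctuation n 1 \<omega> + 1 * fluctuation n 2 \<omega>)\<^sup>2 - fluctuation n 1 \<omega> * fluctuation n 1 \<omega> - fluctuation n 2 \<omega> * fluctuation n 2 \<omega>) / 2" for \<omega>
    by (simp add: power2_eq_square algebra_simps)
  show "integrable M (\<lambda>\<omega>. fluctuation n 1 \<omega> * fluctuation n 2 \<omega>)"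
    unfolding polarization
    by (intro integrable_divide Bochner_Integration.integrable_diff fluctuation_integrable 1 2)
qed

definition scaled_covariance :: "nat \<Rightarrow> nat \<Rightarrow> nat \<Rightarrow> real" where
  "scaled_covariance n i j = real n * covariance M
     (\<lambda>\<omega>. quadratic_variation M X T (i * n) \<omega> / real (i * n))
     (\<lambda>\<omega>. quadratic_variation M X T (j * n) \<omega> / real (j * n))"

lemma fluctuation_covariance:
  "expectation (\<lambda>\<omega>. fluctuation n i \<omega> * fluctuation n j \<omega>) = scaled_covariance n i j"
proof -
  have "fluctuation n i \<omega> * fluctuation n j \<omega> = real n *
    ((quadratic_variation M X T (i * n) \<omega> / real (i * n) - expectation (\<lambda>\<omega>. quadratic_variation M X T (i * n) \<omega> / real (i * n))) *
     (quadratic_variation M X T (j * n) \<omega> / real (j * n) - expectation (\<lambda>\<omega>. quadratic_variation M X T (j * n) \<omega> / real (j * n))))" for \<omega>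
  proof -
    have "fluctuation n i \<omega> * fluctuation n j \<omega> = (sqrt (real n) * sqrt (real n)) *
      ((quadratic_variation M X T (i * n) \<omega> - expectation (quadratic_variation M X T (i * n))) / real (i * n) *
       ((quadratic_variation M X T (j * n) \<omega> - expectation (quadratic_variation M X T (j * n))) / real (j * n)))"
      by (simp only: fluctuation_def mult_ac)
    then show ?thesis
      by (simp only: real_sqrt_mult_self abs_of_nat integral_divide_zero diff_divide_distrib)
  qed
  then show ?thesis by (simp add: scaled_covariance_def covariance_def)
qed

lemma fluctuation_second_moment:
  "expectation (\<lambda>\<omega>. (a * fluctuation n 1 \<omega> + b * fluctuation n 2 \<omega>)\<^sup>2) =
    scaled_covariance n 1 1 * a\<^sup>2 + 2 * scaled_covariance n 1 2 * (a * b) + scaled_covariance n 2 2 * b\<^sup>2"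
proof -
  have "(a * fluctuation n 1 \<omega> + b * fluctuation n 2 \<omega>)\<^sup>2 = (fluctuation n 1 \<omega> * fluctuation n 1 \<omega>) * a\<^sup>2 +
     (fluctuation n 1 \<omega> * fluctuation n 2 \<omega>) * (2 * (a * b)) + (fluctuation n 2 \<omega> * fluctuation n 2 \<omega>) * b\<^sup>2" for \<omega>
    by (simp add: power2_eq_square algebra_simps)
  then show ?thesis
    using fluctuation_products_integrable[of n] by (simp add: fluctuation_covariance)
qed

lemma row_sum_le:
  assumes "max_corr_sum M X T N \<le> C" and k: "k \<in> {1..N-1}"
  shows "(\<Sum>j=1..N-1. \<bar>diff_corr M X T N j k\<bar>) \<le> C"
proof -
  have "2 \<le> N" using k by auto
  then have "(\<Sum>j=1..N-1. \<bar>diff_corr M X T N j k\<bar>) \<le> max_corr_sum M X T N"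
    using k unfolding max_corr_sum_def by (auto intro!: Max_ge)
  with assms(1) show ?thesis by simp
qed

lemma correlation_form_bound:
  assumes C: "\<And>i. i \<in> {1, 2} \<Longrightarrow> max_corr_sum M X T (i * n) \<le> C"
  shows "(\<Sum>k\<in>grid n. \<Sum>l\<in>grid n. c k * c l * vec.R n k l) \<le> 2 * C * (\<Sum>k\<in>grid n. (c k)\<^sup>2)"
proof (rule vec.quadratic_form_two_blocks)
  let ?J = "\<lambda>i. {i} \<times> {1..i * n - 1}"
  show "grid n = ?J 1 \<union> ?J 2" "?J 1 \<inter> ?J 2 = {}" by (auto simp: grid_def)
  have *: "(\<Sum>l\<in>?J i. \<bar>vec.R n k l\<bar>) \<le> C" if k: "k \<in> ?J i" and i: "i \<in> {1, 2}" for i k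
  proof -
    obtain m where m: "k = (i, m)" "m \<in> {1..i * n - 1}" using k by auto
    have "(\<Sum>l\<in>?J i. \<bar>vec.R n k l\<bar>) = (\<Sum>j=1..i * n - 1. \<bar>diff_corr M X T (i * n) j m\<bar>)"
      unfolding m(1)
    proof (rule sum.reindex_bij_witness[of _ "\<lambda>j. (i, j)" snd])
      fix l assume "l \<in> ?J i"
      then obtain j where "l = (i, j)" by auto
      then show "\<bar>diff_corr M X T (i * n) (snd l) m\<bar> = \<bar>vec.R n (i, m) l\<bar>"
        unfolding vec.R_def unfolding increment_def diff_corr_def by (simp add: mult.commute)
    qed auto
    then show ?thesis using row_sum_le[OF C[OF i] m(2)] by simp
  qed
  show "(\<Sum>l\<in>?J 1. \<bar>vec.R n k l\<bar>) \<le> C" if "k \<in> ?J 1" for k using *[OF that] by simp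
  show "(\<Sum>l\<in>?J 2. \<bar>vec.R n k l\<bar>) \<le> C" if "k \<in> ?J 2" for k using *[OF that] by simp
qed

lemma card_grid: "card (grid n) \<le> 3 * n"
  unfolding grid_def by (subst card_SigmaI) auto

text \<open>
  There are at most \<open>3 * n\<close> components, and their weights are at most \<open>(\<bar>a\<bar> + \<bar>b\<bar>) / sqrt n\<close>, so the
  error bound for the characteristic function is of order \<open>n * (1 / sqrt n)^3 = 1 / sqrt n\<close>.
\<close>

lemma char_fluctuation_error:
  assumes n: "1 \<le> n" and C: "\<And>i. i \<in> {1, 2} \<Longrightarrow> max_corr_sum M X T (i * n) \<le> C"
  shows "norm (expectation (\<lambda>\<omega>. iexp (a * fluctuation n 1 \<omega> + b * fluctuation n 2 \<omega>)) -
      of_real (exp (- (scaled_covariance n 1 1 * a\<^sup>2 + 2 * scaled_covariance n 1 2 * (a * b) + scaled_covariance n 2 2 * b\<^sup>2) / 2)))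
    \<le> 12 * (\<bar>a\<bar> + \<bar>b\<bar>) ^ 3 * (2 * (\<bar>C\<bar> + 1))\<^sup>2 / sqrt (real n)"
proof -
  let ?c = "\<lambda>i::nat. if i = 1 then a else b"
  let ?w = "weight n ?c"
  define \<delta> where "\<delta> = (\<bar>a\<bar> + \<bar>b\<bar>) / sqrt (real n)"
  \<comment> \<open>Twice the row sum bound because of the two levels; the summand 1 makes \<open>K\<close> positive.\<close>
  define K where "K = 2 * (\<bar>C\<bar> + 1)"
  have K: "0 < K" by (simp add: K_def)
  have Q: "vec.Q n ?w \<omega> = a * fluctuation n 1 \<omega> + b * fluctuation n 2 \<omega>" for \<omega>
    by (simp add: Q_weight)
  have form: "(\<Sum>k\<in>grid n. \<Sum>l\<in>grid n. c k * c l * vec.R n k l) \<le> K * (\<Sum>k\<in>grid n. (c k)\<^sup>2)" for c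
    unfolding K_def by (rule order_trans[OF correlation_form_bound[OF C]])
      (auto intro!: mult_right_mono sum_nonneg)
  have sn: "0 < sqrt (real n)" using n by simp
  have w: "\<bar>?w l\<bar> \<le> \<delta>" if "l \<in> grid n" for l
  proof -
    have "fst l = 1 \<or> fst l = 2" using that by (auto simp: grid_def)
    then obtain i k where l: "l = (i, k)" "i = 1 \<or> i = 2" by (metis prod.collapse)
    have "\<bar>?w l\<bar> = \<bar>?c i\<bar> / (real i * sqrt (real n))"
    proof -
      have "sqrt (real n) / (real i * real n) = 1 / (real i * sqrt (real n))"
        using sn real_div_sqrt[of "real n"] by (simp add: divide_simps)
      then have "?w l = ?c i * (1 / (real i * sqrt (real n)))"
        unfolding l weight_def by (simp only: prod.case times_divide_eq_right[symmetric] of_nat_mult)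
      then show ?thesis by (simp add: abs_mult)
    qed
    also have "\<dots> \<le> (\<bar>a\<bar> + \<bar>b\<bar>) / sqrt (real n)"
      using l(2) sn by (intro frac_le) auto
    finally show ?thesis by (simp add: \<delta>_def)
  qed
  have \<delta>0: "0 \<le> \<delta>" by (simp add: \<delta>_def)
  have "norm (expectation (\<lambda>\<omega>. iexp (vec.Q n ?w \<omega>)) - of_real (exp (- expectation (\<lambda>\<omega>. (vec.Q n ?w \<omega>)\<^sup>2) / 2)))
    \<le> 4 * real (card (grid n)) * \<delta> ^ 3 * K\<^sup>2"
    by (rule vec.characteristic_function_quadratic_form[OF K form w \<delta>0])
  also have "\<dots> \<le> 4 * (3 * real n) * \<delta> ^ 3 * K\<^sup>2"
    using card_grid[of n] \<delta>0 by (intro mult_right_mono mult_left_mono) auto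
  also have "\<dots> = 12 * K\<^sup>2 * (real n * \<delta> ^ 3)" by simp
  also have "real n * \<delta> ^ 3 = (\<bar>a\<bar> + \<bar>b\<bar>) ^ 3 * (real n / sqrt (real n) ^ 3)"
    by (simp add: \<delta>_def power_divide)
  also have "real n / sqrt (real n) ^ 3 = 1 / sqrt (real n)"
    using sn real_sqrt_mult_self[of "real n"] by (simp add: power3_eq_cube field_simps)
  also have "12 * K\<^sup>2 * ((\<bar>a\<bar> + \<bar>b\<bar>) ^ 3 * (1 / sqrt (real n))) = 12 * (\<bar>a\<bar> + \<bar>b\<bar>) ^ 3 * K\<^sup>2 / sqrt (real n)"
    by simp
  finally show ?thesis unfolding Q fluctuation_second_moment K_def .
qed

end

theorem theorem4:
  fixes M :: "'a measure" and X :: "real \<Rightarrow> 'a \<Rightarrow> real" and T C :: real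
    and S :: "nat \<Rightarrow> nat \<Rightarrow> real"
  assumes "prob_space M"
    and "0 < T"
    and "gaussian_process M {0..T} X"
    and "\<And>t. t \<in> {0..T} \<Longrightarrow> (\<integral>\<omega>. X t \<omega> \<partial>M) = 0"
    and "AE \<omega> in M. X 0 \<omega> = 0"
    and "\<And>N k. 2 \<le> N \<Longrightarrow> k \<in> {1..N-1} \<Longrightarrow> 0 < (\<integral>\<omega>. (second_diff X T N k \<omega>)\<^sup>2 \<partial>M)"
    and "\<And>n i. 1 \<le> n \<Longrightarrow> i \<in> {1, 2} \<Longrightarrow> max_corr_sum M X T (i * n) \<le> C"
    and "\<And>i j. i \<in> {1, 2} \<Longrightarrow> j \<in> {1, 2} \<Longrightarrow>
      (\<lambda>n. real n * covariance M
              (\<lambda>\<omega>. quadratic_variation M X T (i * n) \<omega> / real (i * n))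
              (\<lambda>\<omega>. quadratic_variation M X T (j * n) \<omega> / real (j * n)))
        \<longlonglongrightarrow> S i j"
  shows "\<exists>\<nu>. is_multivariate_normal 0
                (vector [vector [S 1 1, S 1 2], vector [S 1 2, S 2 2]] :: real ^ 2 ^ 2) \<nu> \<and>
    converges_in_distribution M
      (\<lambda>n \<omega>. sqrt (real n) *\<^sub>R
        (vector
          [(quadratic_variation M X T n \<omega> - (\<integral>\<omega>'. quadratic_variation M X T n \<omega>' \<partial>M)) / real n,
           (quadratic_variation M X T (2 * n) \<omega>
              - (\<integral>\<omega>'. quadratic_variation M X T (2 * n) \<omega>' \<partial>M)) / real (2 * n)] :: real ^ 2))
      \<nu>"
proof -
  interpret prob_space M by fact
  interpret gaussian_second_differences M X T
    by unfold_locales (use assms(2-4,6) in auto)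
  let ?Z = "\<lambda>n \<omega>. sqrt (real n) *\<^sub>R
        (vector
          [(quadratic_variation M X T n \<omega> - (\<integral>\<omega>'. quadratic_variation M X T n \<omega>' \<partial>M)) / real n,
           (quadratic_variation M X T (2 * n) \<omega>
              - (\<integral>\<omega>'. quadratic_variation M X T (2 * n) \<omega>' \<partial>M)) / real (2 * n)] :: real ^ 2)"
  have Z1: "?Z n \<omega> $ 1 = fluctuation n 1 \<omega>" and Z2: "?Z n \<omega> $ 2 = fluctuation n 2 \<omega>" for n \<omega>
    by (simp_all add: fluctuation_def vector_2)
  have inner: "c \<bullet> ?Z n \<omega> = c $ 1 * fluctuation n 1 \<omega> + c $ 2 * fluctuation n 2 \<omega>" for c n \<omega>
    unfolding inner_vec_def sum_2 Z1 Z2 by simp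
  have nrm: "(norm (?Z n \<omega>))\<^sup>2 = fluctuation n 1 \<omega> * fluctuation n 1 \<omega> + fluctuation n 2 \<omega> * fluctuation n 2 \<omega>" for n \<omega>
    unfolding power2_norm_eq_inner inner Z1 Z2 ..
  define quad where "quad a b = S 1 1 * a\<^sup>2 + 2 * S 1 2 * (a * b) + S 2 2 * b\<^sup>2" for a b
  have scaled_covariance: "(\<lambda>n. scaled_covariance n 1 1) \<longlonglongrightarrow> S 1 1" "(\<lambda>n. scaled_covariance n 1 2) \<longlonglongrightarrow> S 1 2" "(\<lambda>n. scaled_covariance n 2 2) \<longlonglongrightarrow> S 2 2"
    unfolding scaled_covariance_def by (rule assms(8); simp)+
  have quad: "(\<lambda>n. scaled_covariance n 1 1 * a\<^sup>2 + 2 * scaled_covariance n 1 2 * (a * b) + scaled_covariance n 2 2 * b\<^sup>2) \<longlonglongrightarrow> quad a b" for a b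
    unfolding quad_def by (intro tendsto_intros scaled_covariance)
  \<comment> \<open>The matrix \<open>S\<close> is positive semidefinite as a limit of covariance matrices.\<close>
  have psd: "0 \<le> S 1 1 * a\<^sup>2 + 2 * S 1 2 * (a * b) + S 2 2 * b\<^sup>2" for a b
    unfolding quad_def[symmetric]
    by (rule LIMSEQ_le_const[OF quad])
      (unfold fluctuation_second_moment[symmetric], intro exI[of _ 0] allI impI Bochner_Integration.integral_nonneg zero_le_power2)
  obtain \<nu> :: "(real ^ 2) measure" where \<nu>:
    "is_multivariate_normal 0 (vector [vector [S 1 1, S 1 2], vector [S 1 2, S 2 2]]) \<nu>"
    "\<And>c. (\<integral>x. iexp (c \<bullet> x) \<partial>\<nu>) = of_real (exp (- quad (c $ 1) (c $ 2) / 2))"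
    "integrable \<nu> (\<lambda>x. (norm x)\<^sup>2)"
    using bivariate_normal_exists[OF psd] unfolding quad_def by blast
  have char: "(\<lambda>n. \<integral>\<omega>. iexp (c \<bullet> ?Z n \<omega>) \<partial>M) \<longlonglongrightarrow> (\<integral>x. iexp (c \<bullet> x) \<partial>\<nu>)" for c
  proof -
    let ?v = "\<lambda>n. scaled_covariance n 1 1 * (c $ 1)\<^sup>2 + 2 * scaled_covariance n 1 2 * (c $ 1 * c $ 2) + scaled_covariance n 2 2 * (c $ 2)\<^sup>2"
    have error: "(\<lambda>n. expectation (\<lambda>\<omega>. iexp (c \<bullet> ?Z n \<omega>)) - of_real (exp (- ?v n / 2))) \<longlonglongrightarrow> 0"
    proof (rule Lim_null_comparison)
      show "\<forall>\<^sub>F n in sequentially. norm (expectation (\<lambda>\<omega>. iexp (c \<bullet> ?Z n \<omega>)) - of_real (exp (- ?v n / 2)))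
        \<le> 12 * (\<bar>c $ 1\<bar> + \<bar>c $ 2\<bar>) ^ 3 * (2 * (\<bar>C\<bar> + 1))\<^sup>2 / sqrt (real n)"
        using eventually_ge_at_top[of 1]
      proof eventually_elim
        case (elim n)
        show ?case unfolding inner by (rule char_fluctuation_error[OF elim assms(7)[OF elim]])
      qed
      show "(\<lambda>n. 12 * (\<bar>c $ 1\<bar> + \<bar>c $ 2\<bar>) ^ 3 * (2 * (\<bar>C\<bar> + 1))\<^sup>2 / sqrt (real n)) \<longlonglongrightarrow> 0"
        by real_asymp
    qed
    have "(\<lambda>n. of_real (exp (- ?v n / 2)) :: complex) \<longlonglongrightarrow> of_real (exp (- quad (c $ 1) (c $ 2) / 2))"
      by (intro tendsto_intros quad) simp
    from Lim_transform[OF this error] show ?thesis unfolding \<nu>(2) .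
  qed
  have "converges_in_distribution M ?Z \<nu>"
  proof (rule levy_continuity_bounded_second_moment[OF assms(1) _ _ _ _ \<nu>(3) _ char])
    show "prob_space \<nu>" "sets \<nu> = sets borel"
      using \<nu>(1) by (simp_all add: is_multivariate_normal_def)
    show "?Z n \<in> borel_measurable M" for n
      unfolding borel_measurable_euclidean_space[of "?Z n"]
      by (subst inner_commute, unfold inner) (intro ballI, measurable)
    show "integrable M (\<lambda>\<omega>. (norm (?Z n \<omega>))\<^sup>2)" for n
      unfolding nrm by (intro Bochner_Integration.integrable_add fluctuation_products_integrable)
    have "(\<lambda>n. scaled_covariance n 1 1 + scaled_covariance n 2 2) \<longlonglongrightarrow> S 1 1 + S 2 2" by (intro tendsto_intros scaled_covariance)
    then have "\<forall>\<^sub>F n in sequentially. scaled_covariance n 1 1 + scaled_covariance n 2 2 < S 1 1 + S 2 2 + 1"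
      by (rule order_tendstoD) simp
    then show "\<forall>\<^sub>F n in sequentially. (\<integral>\<omega>. (norm (?Z n \<omega>))\<^sup>2 \<partial>M) \<le> S 1 1 + S 2 2 + 1"
    proof eventually_elim
      case (elim n)
      then show ?case unfolding nrm
        using fluctuation_products_integrable[of n] by (simp add: fluctuation_covariance)
    qed
  qed
  with \<nu>(1) show ?thesis by blast
qed

end
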